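(* Assume $\lambda<\sum_{i=1}^n\mu_i$. There exist a constant $\gamma$ with $0<\gamma\le1$, a function $\mathcal L:\mathcal A\to\mathbb R_+$ of the form $$\mathcal L(\alpha)=\sum_{i=1}^n\alpha_i^{1+\gamma},\qquad \alpha=(\alpha_1,\dots,\alpha_n,l)\in\mathcal A,$$ a positive constant $\epsilon$ and a finite non-empty set $A\subset\mathcal A$, such that for all $k\ge0$ and all $\alpha\in\mathcal A^*\setminus A$, $$\mathbb E_\alpha\big[(\mathcal L(Y_{k+1})-\mathcal L(Y_k))\mathbf 1_{\{k<\sigma\}}\mid\mathcal F^\xi_{\tau_k}\big]\le-\epsilon\,\mathbb E_\alpha\big[(\tau_{k+1}-\tau_k)\mathbf 1_{\{k<\sigma\}}\mid\mathcal F^\xi_{\tau_k}\big],$$ where $\sigma=\inf\{k\ge0: Y_k\in A\}$.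
   Context: **Primitives.** There are $n$ servers; $[n]=\{1,\dots,n\}$, $\mathbb N=\{0,1,2,\dots\}$, $[x]^+=\max\{x,0\}$. The arrivals $\{a(t)\}_{t\ge1}$ are i.i.d. $\mathbb N$-valued random variables with $\mathbb P(a(1)=0)>0$, finite mean $\lambda$ and finite standard deviation $\sigma_a$. For each $i\in[n]$, the service capacities $\{s_i(t)\}_{t\ge1}$ are i.i.d. integer-valued random variables with $1\le s_i(t)\le s_{max}$ for a constant $s_{max}\in\mathbb N$, and with mean $\mu_i$ and standard deviation $\sigma_{s_i}$. The sequences $\{a(t)\},\{s_1(t)\},\dots,\{s_n(t)\}$ are mutually independent and independent of the initial condition $X(0)$. **Chain (Persistent-Idle policy).** $X(t)=(Q(t),LI(t))$ with $Q(t)=(Q_1(t),\dots,Q_n(t))\in\mathbb N^n$ (queue lengths at the end of slot $t$) and $LI(t)\in[n]$ (the Last-Idle server, to which all jobs arriving in slot $t$ are sent). Let $I(t)=\{i:Q_i(t)=0\}$. For $t>0$, $$Q_i(t)=[Q_i(t-1)+a(t)\mathbf 1_{\{LI(t)=i\}}-s_i(t)]^+,\qquad LI(t)=\begin{cases}LI(t-1),&|I(t-1)|=0,\\ \xi_t,&\text{otherwise,}\end{cases}$$ where the conditional distribution of $\xi_t$ given $(X(0),\dots,X(t-1),a(t),s_1(t),\dots,s_n(t))$ is uniform on $I(t-1)$ on the event $\{|I(t-1)|>0\}$, and $\xi_t=1$ on $\{|I(t-1)|=0\}$. For each $t\geq 1$, $(a(t),s_1(t),\dots,s_n(t))$ is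 independent of $X(0)$, $(a(u),s_1(u),\dots,s_n(u))_{u<t}$ and $(\xi_u)_{u\le t}$ jointly. **State space.** $\mathcal A\subset\mathbb N^n\times[n]$ is the set of all states $\alpha=(\alpha_1,\dots,\alpha_n,l)$ that can be reached with positive probability from any of the states $(0,\dots,0,i)$, $i\in[n]$. It is assumed that $X(0)\in\mathcal A$ almost surely; then $X$ is an irreducible, aperiodic, homogeneous Markov chain on $\mathcal A$. $\mathbb E_\alpha[\cdot]=\mathbb E[\cdot\mid X(0)=\alpha]$. **Sampled chain.** Let $\mathcal F^\xi_t=\sigma(X(0),\dots,X(t),\xi_1,\dots,\xi_{t+1})$ (the generated $\sigma$-algebra). Let $\Omega_t=\{\exists i \text{ such that } Q_i(t)=0,\ i\ne LI(t)\}$. Define the stopping times $$\tau_0=\inf\{t\ge1:\mathbf 1_{\Omega_t}=1\},\qquad \tau_{k+1}=\inf\{t>\tau_k:\mathbf 1_{\Omega_t}=1\},\quad k=0,1,2,\dots,$$ which are a.s. finite, and $\mathcal F^\xi_{\tau_k}$ is the $\sigma$-algebra of the stopping time $\tau_k$ with respect to $(\mathcal F^\xi_t)_{t\ge0}$. The sampled chain is $Y_k=X(\tau_k)$, $k\ge0$. Finally $$\mathcal A^*=\{\alpha=(\alpha_1,\dots,\alpha_n,l)\in\mathcal A:\ \alpha_i=0\text{ for some } i\ne l\}.$$ *)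

theory Defs
  imports "HOL-Probability.Probability"
begin

text \<open>
  The set of servers is the universe of a finite type \<open>'n\<close>, and a state
  \<open>(q, l)\<close> consists of the queue lengths \<open>q\<close> and the Last-Idle server \<open>l\<close>.  A state is
  always equipped with the discrete \<open>\<sigma>\<close>-algebra (the state type is countable).
\<close>

type_synonym 'n state = "('n \<Rightarrow> nat) \<times> 'n"

definition idle :: "('n \<Rightarrow> nat) \<Rightarrow> 'n set" where
  "idle q = {i. q i = 0}"

text \<open>
  One slot of the Persistent-Idle recursion, given the tie-breaking server \<open>x\<close>, the number of
  arrivals \<open>a\<close> and the service capacities \<open>s\<close>.  Subtraction on \<^typ>\<open>nat\<close> is truncated at 0,
  which is the positive part in the queue recursion.
\<close>

definition next_state :: "'n \<Rightarrow> nat \<Rightarrow> ('n \<Rightarrow> nat) \<Rightarrow> 'n state \<Rightarrow> 'n state" where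
  "next_state x a s = (\<lambda>(q, l).
     let l' = (if idle q = {} then l else x)
     in (\<lambda>i. (q i + (if i = l' then a else 0)) - s i, l'))"

text \<open>
  Conditional law of \<open>\<xi>\<^sub>t\<close> given that the queue lengths at the end of the previous slot are \<open>q\<close>.
  The server \<open>i1\<close> is the one labelled 1; it is an arbitrary fixed element of \<open>'n\<close>.
\<close>

definition xi_law :: "'n \<Rightarrow> ('n::finite \<Rightarrow> nat) \<Rightarrow> 'n pmf" where
  "xi_law i1 q = (if idle q = {} then return_pmf i1 else pmf_of_set (idle q))"

text \<open>
  Transition kernel of the chain, its iterates, and the state space: the states reached with
  positive probability from a state with empty queues.  (The states with empty queues reach one
  another in a single slot without arrivals, so it is immaterial whether one starts from some or
  from every such state, and whether 0 steps are allowed.)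
\<close>

definition kernel ::
  "'n \<Rightarrow> nat pmf \<Rightarrow> ('n::finite \<Rightarrow> nat pmf) \<Rightarrow> 'n state \<Rightarrow> 'n state pmf" where
  "kernel i1 pa ps \<alpha> =
     bind_pmf (xi_law i1 (fst \<alpha>)) (\<lambda>x.
     bind_pmf pa (\<lambda>a.
     bind_pmf (Pi_pmf UNIV 0 ps) (\<lambda>s.
     return_pmf (next_state x a s \<alpha>))))"

primrec kernel_pow ::
  "'n \<Rightarrow> nat pmf \<Rightarrow> ('n::finite \<Rightarrow> nat pmf) \<Rightarrow> nat \<Rightarrow> 'n state \<Rightarrow> 'n state pmf" where
  "kernel_pow i1 pa ps 0 \<alpha> = return_pmf \<alpha>"
| "kernel_pow i1 pa ps (Suc t) \<alpha> = bind_pmf (kernel_pow i1 pa ps t \<alpha>) (kernel i1 pa ps)"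

definition state_space ::
  "'n \<Rightarrow> nat pmf \<Rightarrow> ('n::finite \<Rightarrow> nat pmf) \<Rightarrow> 'n state set" where
  "state_space i1 pa ps = {\<alpha>. \<exists>i t. pmf (kernel_pow i1 pa ps t (\<lambda>_. 0, i)) \<alpha> > 0}"

definition nonLI_idle :: "'n state \<Rightarrow> bool" where
  "nonLI_idle \<alpha> \<longleftrightarrow> (\<exists>i. fst \<alpha> i = 0 \<and> i \<noteq> snd \<alpha>)"

definition state_space_star ::
  "'n \<Rightarrow> nat pmf \<Rightarrow> ('n::finite \<Rightarrow> nat pmf) \<Rightarrow> 'n state set" where
  "state_space_star i1 pa ps = {\<alpha> \<in> state_space i1 pa ps. nonLI_idle \<alpha>}"

text \<open>
  The joint family of driving variables: index \<open>(None, t)\<close> is \<open>a(t)\<close>, index \<open>(Some i, t)\<close> is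
  \<open>s\<^sub>i(t)\<close>.
\<close>

definition driver ::
  "(nat \<Rightarrow> 'w \<Rightarrow> nat) \<Rightarrow> ('n \<Rightarrow> nat \<Rightarrow> 'w \<Rightarrow> nat) \<Rightarrow> 'n option \<times> nat \<Rightarrow> 'w \<Rightarrow> nat" where
  "driver a s = (\<lambda>(j, t). case j of None \<Rightarrow> a t | Some i \<Rightarrow> s i t)"

text \<open>
  Independence of two random variables whose values may be of different types
  (\<open>indep_var\<close> requires the same type).
\<close>

definition (in prob_space) indep_rv ::
  "'b measure \<Rightarrow> ('a \<Rightarrow> 'b) \<Rightarrow> 'c measure \<Rightarrow> ('a \<Rightarrow> 'c) \<Rightarrow> bool" where
  "indep_rv S U T V \<longleftrightarrow> U \<in> measurable M S \<and> V \<in> measurable M T \<and>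
     indep_set (sets (vimage_algebra (space M) U S)) (sets (vimage_algebra (space M) V T))"

text \<open>
  Independence of all the variables in \<open>drivers_indep\<close> combines independence within and between
  the sequences \<open>a\<close>, \<open>s\<^sub>1\<close>, \<dots>, \<open>s\<^sub>n\<close>.  All variables are discrete, so conditional distributions
  given finitely many of them are elementary conditional probabilities.
\<close>

locale persistent_idle = prob_space M
  for M :: "'w measure" +
  fixes i1 :: "'n::finite"
    and pa :: "nat pmf"
    and ps :: "'n \<Rightarrow> nat pmf"
    and a :: "nat \<Rightarrow> 'w \<Rightarrow> nat"
    and s :: "'n \<Rightarrow> nat \<Rightarrow> 'w \<Rightarrow> nat"
    and \<xi> :: "nat \<Rightarrow> 'w \<Rightarrow> 'n"
    and X :: "nat \<Rightarrow> 'w \<Rightarrow> 'n state"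
  assumes law_a: "t \<ge> 1 \<Longrightarrow> distr M (count_space UNIV) (a t) = measure_pmf pa"
    and law_s: "t \<ge> 1 \<Longrightarrow> distr M (count_space UNIV) (s i t) = measure_pmf (ps i)"
    and drivers_indep: "indep_vars (\<lambda>_. count_space UNIV) (driver a s) (UNIV \<times> {1..})"
    and X0_indep: "indep_rv (count_space UNIV) (X 0)
          (Pi\<^sub>M (UNIV \<times> {1..}) (\<lambda>_. count_space UNIV))
          (\<lambda>\<omega>. \<lambda>j\<in>UNIV \<times> {1..}. driver a s j \<omega>)"
    and X0_state_space: "AE \<omega> in M. X 0 \<omega> \<in> state_space i1 pa ps"
    and xi_measurable: "t \<ge> 1 \<Longrightarrow> \<xi> t \<in> measurable M (count_space UNIV)"
    and X_recursion: "t \<ge> 1 \<Longrightarrow> \<omega> \<in> space M \<Longrightarrow>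
          X t \<omega> = next_state (\<xi> t \<omega>) (a t \<omega>) (\<lambda>i. s i t \<omega>) (X (t - 1) \<omega>)"
    and xi_conditional_law: "t \<ge> 1 \<Longrightarrow>
          \<P>(\<omega> in M. (\<forall>u<t. X u \<omega> = x u) \<and> a t \<omega> = b \<and> (\<forall>i. s i t \<omega> = c i)) > 0 \<Longrightarrow>
          \<P>(\<omega> in M. \<xi> t \<omega> = l \<bar>
              (\<forall>u<t. X u \<omega> = x u) \<and> a t \<omega> = b \<and> (\<forall>i. s i t \<omega> = c i))
            = pmf (xi_law i1 (fst (x (t - 1)))) l"
    and inputs_indep_past: "t \<ge> 1 \<Longrightarrow>
          indep_rv
            (count_space UNIV) (\<lambda>\<omega>. (a t \<omega>, \<lambda>i. s i t \<omega>))
            (count_space UNIV) (\<lambda>\<omega>. (X 0 \<omega>,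
               map (\<lambda>u. (a u \<omega>, \<lambda>i. s i u \<omega>)) [1..<t],
               map (\<lambda>u. \<xi> u \<omega>) [1..<Suc t]))"

text \<open>
  The filtration \<open>\<F>\<^sup>\<xi>\<^sub>t = \<sigma>(X(0), \<dots>, X(t), \<xi>\<^sub>1, \<dots>, \<xi>\<^sub>t\<^sub>+\<^sub>1)\<close>, with the time \<open>\<infinity>\<close> adjoined,
  where it is generated by all \<open>X(u)\<close> and \<open>\<xi>\<^sub>u\<close>.
\<close>

definition xi_filtration ::
  "'w measure \<Rightarrow> (nat \<Rightarrow> 'w \<Rightarrow> 'n) \<Rightarrow> (nat \<Rightarrow> 'w \<Rightarrow> 'n state) \<Rightarrow> enat \<Rightarrow> 'w measure" where
  "xi_filtration M \<xi> X t = sigma (space M)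
     ({X u -` B \<inter> space M | u B. enat u \<le> t} \<union>
      {\<xi> u -` B \<inter> space M | u B. 1 \<le> u \<and> enat u \<le> t + 1})"

text \<open>
  The sampling times; the infimum of the empty set of times is \<open>\<infinity>\<close>.
\<close>

primrec samp_time :: "(nat \<Rightarrow> 'w \<Rightarrow> 'n state) \<Rightarrow> nat \<Rightarrow> 'w \<Rightarrow> enat" where
  "samp_time X 0 \<omega> = Inf (enat ` {t. t \<ge> 1 \<and> nonLI_idle (X t \<omega>)})"
| "samp_time X (Suc k) \<omega> =
     Inf (enat ` {t. enat t > samp_time X k \<omega> \<and> nonLI_idle (X t \<omega>)})"

definition samp_sigma ::
  "'w measure \<Rightarrow> (nat \<Rightarrow> 'w \<Rightarrow> 'n) \<Rightarrow> (nat \<Rightarrow> 'w \<Rightarrow> 'n state) \<Rightarrow> nat \<Rightarrow> 'w measure" where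
  "samp_sigma M \<xi> X k =
     filtration.pre_sigma (space M) (xi_filtration M \<xi> X) (samp_time X k)"

text \<open>
  The sampling times are almost surely finite (when there are at least two servers), so the
  value of \<^const>\<open>the_enat\<close> at \<open>\<infinity>\<close> matters on a null set only.
\<close>

definition samp_chain :: "(nat \<Rightarrow> 'w \<Rightarrow> 'n state) \<Rightarrow> nat \<Rightarrow> 'w \<Rightarrow> 'n state" where
  "samp_chain X k \<omega> = X (the_enat (samp_time X k \<omega>)) \<omega>"

definition samp_gap :: "(nat \<Rightarrow> 'w \<Rightarrow> 'n state) \<Rightarrow> nat \<Rightarrow> 'w \<Rightarrow> real" where
  "samp_gap X k \<omega> =
     real (the_enat (samp_time X (Suc k) \<omega>)) - real (the_enat (samp_time X k \<omega>))"

definition hit_time :: "(nat \<Rightarrow> 'w \<Rightarrow> 'n state) \<Rightarrow> 'n state set \<Rightarrow> 'w \<Rightarrow> enat" where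
  "hit_time X A \<omega> = Inf (enat ` {k. samp_chain X k \<omega> \<in> A})"

text \<open>
  The probability measure behind \<open>\<bbbE>\<^sub>\<alpha>\<close>: \<open>M\<close> conditioned on \<open>X(0) = \<alpha>\<close>.
\<close>

definition started_at :: "'w measure \<Rightarrow> (nat \<Rightarrow> 'w \<Rightarrow> 'n state) \<Rightarrow> 'n state \<Rightarrow> 'w measure" where
  "started_at M X \<alpha> = uniform_measure M {\<omega> \<in> space M. X 0 \<omega> = \<alpha>}"

definition lyapunov :: "real \<Rightarrow> ('n::finite) state \<Rightarrow> real" where
  "lyapunov \<gamma> \<alpha> = (\<Sum>i\<in>UNIV. real (fst \<alpha> i) powr (1 + \<gamma>))"

end

theory Submission
  imports Defs
begin

text \<open>
  Fix a sampling time \<open>t\<close> with queue lengths \<open>q\<close>.  The \<open>\<sigma>\<close>-algebra at that time already contains the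
  tie-breaking choice \<open>j = \<xi>\<^sub>t\<^sub>+\<^sub>1\<close>, an idle server, so the drift has to be negative for every choice of
  \<open>j\<close> separately.  Until the next sampling time every job goes to \<open>j\<close>: queue \<open>j\<close> starts at 0 and moves
  like a random walk reflected at 0, whereas every other queue only drains, by \<open>S\<^sub>i(u)\<close> after
  \<open>u\<close> slots, and the excursion ends when one of them becomes empty.  As each server works off at least
  one and at most \<open>smax\<close> jobs per slot, the length \<open>T\<close> of the excursion satisfies \<open>T \<le> max 1 m\<close> and
  \<open>m \<le> smax T\<close>, where \<open>m\<close> is the least of the other queues (lemmas \<open>T_le\<close>, \<open>queue_emptied\<close>).

  The decrease of \<open>q\<^sub>i powr (1 + \<gamma>)\<close> is at least \<open>(q\<^sub>i powr \<gamma>) min q\<^sub>i S\<^sub>i(T)\<close>, and two cases remain.  If \<open>m\<close> is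
  bounded, then so is \<open>T\<close>; outside a finite set some queue exceeds a large \<open>R\<close>, and its decrease, at
  least \<open>(R powr \<gamma>) T\<close>, outweighs the arrivals (\<open>drift_some_queue_short\<close>).  If \<open>m\<close> is large, then
  \<open>y powr (1 + \<gamma>) \<le> (m powr \<gamma>) (y + \<gamma> y\<^sup>2 / m)\<close> for the final length \<open>y\<close> of queue \<open>j\<close>.  The quadratic term has
  mean of order \<open>\<gamma> m\<close>, hence of order \<open>\<gamma> T\<close>, and is made harmless by a small \<open>\<gamma>\<close>.  What is left
  is \<open>y - \<Sum>\<^sub>i\<^sub>\<noteq>\<^sub>j S\<^sub>i(T)\<close>, whose mean is at most \<open>c - \<delta> \<bbbE> T\<close> because the total arrival rate is smaller than the
  total service rate; the reflection at 0 is absorbed by replacing \<open>y\<close> with \<open>sqrt (y\<^sup>2 + c\<^sup>2)\<close>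
  (\<open>drift_all_queues_long\<close>).  The means are taken slot by slot, from the independence of the inputs of a
  slot from the past (\<open>smooth_increment_nonpos\<close>, \<open>negative_drift\<close>).

  All variables are discrete, so the estimates are carried out on events of the form
  \<open>\<tau>\<^sub>k = t, X(t) = \<alpha>, \<xi>\<^sub>t\<^sub>+\<^sub>1 = j\<close> and summed (\<open>negative_drift_random_time\<close>); integrated over the sets of
  the stopped \<open>\<sigma>\<close>-algebra they give the inequality of conditional expectations
  (\<open>conditional_drift\<close>).  Integrability follows by induction on \<open>k\<close>, as one excursion multiplies
  second moments of the queue lengths by at most a constant (\<open>energy_growth_random_time\<close>).
\<close>

section \<open>Inequalities for powers and for the smoothed absolute value\<close>

text \<open>
  With \<open>z = x / m\<close> this is Young's inequality \<open>z powr \<gamma> \<le> \<gamma> z + (1 - \<gamma>)\<close>.  It trades the power of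
  the queue that receives the arrivals for its first and second moments.
\<close>

lemma powr_add_one_le_quadratic:
  fixes x m \<gamma> :: real
  assumes "0 \<le> x" "0 < m" "0 < \<gamma>" "\<gamma> \<le> 1"
  shows "x powr (1 + \<gamma>) \<le> m powr \<gamma> * (x + \<gamma> * x\<^sup>2 / m)"
proof (cases "x = 0")
  case False
  define z where "z = x / m"
  have z: "z > 0" and x: "x = m * z" using False assms by (auto simp: z_def)
  have "z powr \<gamma> * 1 powr (1 - \<gamma>) \<le> \<gamma> * z + (1 - \<gamma>) * 1"
    by (rule Youngs_inequality_0) (use assms z in auto)
  then have "z powr \<gamma> \<le> 1 + \<gamma> * z" using assms by simp
  then have *: "z * z powr \<gamma> \<le> z * (1 + \<gamma> * z)" using z by (intro mult_left_mono) auto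
  have "m * m powr \<gamma> * (z * z powr \<gamma>) \<le> m * m powr \<gamma> * (z * (1 + \<gamma> * z))"
    by (rule mult_left_mono[OF *]) (use assms in simp)
  moreover have "x powr (1 + \<gamma>) = m * m powr \<gamma> * (z * z powr \<gamma>)"
    using assms z by (simp add: x powr_mult powr_add)
  moreover have "m powr \<gamma> * (x + \<gamma> * x\<^sup>2 / m) = m * m powr \<gamma> * (z * (1 + \<gamma> * z))"
    using assms by (simp add: x power2_eq_square field_simps)
  ultimately show ?thesis by linarith
qed simp

text \<open>
  Holds since \<open>y powr \<gamma> \<le> q powr \<gamma>\<close>; linear in the work done, \<open>q - y\<close>, so that its mean
  is governed by the mean service rates.
\<close>

lemma powr_add_one_drop:
  fixes y q \<gamma> :: real
  assumes "0 \<le> y" "y \<le> q" "0 < \<gamma>"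
  shows "y powr (1 + \<gamma>) \<le> q powr (1 + \<gamma>) - q powr \<gamma> * (q - y)"
proof -
  have "y powr (1 + \<gamma>) = y * y powr \<gamma>" "q powr (1 + \<gamma>) = q * q powr \<gamma>"
    using assms by (cases "y = 0"; cases "q = 0"; simp add: powr_add)+
  moreover have "y * y powr \<gamma> \<le> y * q powr \<gamma>"
    using assms by (intro mult_left_mono powr_mono2) auto
  ultimately show ?thesis by (simp add: algebra_simps)
qed

lemma nat_powr_add_one_le_square:
  assumes "0 < \<gamma>" "\<gamma> \<le> 1"
  shows "real x powr (1 + \<gamma>) \<le> (real x)\<^sup>2"
proof (cases "x = 0")
  case False
  then have "real x powr (1 + \<gamma>) \<le> real x powr 2" using assms by (intro powr_mono) auto
  then show ?thesis using False by simp
qed simp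

text \<open>
  The square root is concave, so \<open>sqrt (y\<^sup>2 + c\<^sup>2)\<close> lies below the tangent at \<open>x\<^sup>2 + c\<^sup>2\<close>.  The hypothesis
  on \<open>y\<close> covers the reflected step \<open>y = max 0 (x + a - s)\<close>, so the wasted capacity needs no separate
  estimate.  The price is the second moment term, small for large \<open>c\<close>.
\<close>

lemma smooth_abs_step:
  fixes c x a s :: real
  assumes c: "0 < c" and x: "0 \<le> x" and a: "0 \<le> a" and s: "0 \<le> s" "s \<le> smax"
    and y: "0 \<le> y" "y\<^sup>2 \<le> (x + a - s)\<^sup>2"
  shows "sqrt (y\<^sup>2 + c\<^sup>2) \<le> sqrt (x\<^sup>2 + c\<^sup>2)
    + x / sqrt (x\<^sup>2 + c\<^sup>2) * (a - s) + (a\<^sup>2 + smax\<^sup>2) / (2 * c)"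
proof -
  define p where "p = sqrt (x\<^sup>2 + c\<^sup>2)"
  have pc: "p \<ge> c" unfolding p_def using c by (intro real_le_rsqrt) simp
  then have p: "p > 0" using c by linarith
  have p2: "p\<^sup>2 = x\<^sup>2 + c\<^sup>2" unfolding p_def by simp
  define r where "r = sqrt (y\<^sup>2 + c\<^sup>2)"
  have r: "r\<^sup>2 = y\<^sup>2 + c\<^sup>2" "r \<ge> 0" unfolding r_def by simp_all
  have as: "(a - s)\<^sup>2 \<le> a\<^sup>2 + smax\<^sup>2"
  proof -
    have "s\<^sup>2 \<le> smax\<^sup>2" using s by (intro power_mono)
    moreover have "0 \<le> a * s" using a s by simp
    ultimately show ?thesis by (simp add: power2_diff)
  qed
  have "0 \<le> (r - p)\<^sup>2" by simp
  then have "2 * r * p \<le> r\<^sup>2 + p\<^sup>2" by (simp add: power2_diff)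
  also have "\<dots> \<le> 2 * p\<^sup>2 + 2 * x * (a - s) + (a - s)\<^sup>2"
    using y(2) r(1) p2 by (simp add: power2_eq_square algebra_simps)
  finally have "2 * r * p \<le> 2 * p\<^sup>2 + 2 * x * (a - s) + (a - s)\<^sup>2" .
  then have "r \<le> (2 * p\<^sup>2 + 2 * x * (a - s) + (a - s)\<^sup>2) / (2 * p)"
    using p by (simp add: field_simps)
  also have "\<dots> = p + x / p * (a - s) + (a - s)\<^sup>2 / (2 * p)"
    using p by (simp add: field_simps power2_eq_square)
  also have "(a - s)\<^sup>2 / (2 * p) \<le> (a\<^sup>2 + smax\<^sup>2) / (2 * c)"
    using as pc c by (intro frac_le) auto
  finally show ?thesis unfolding p_def r_def by simp
qed

text \<open>
  Second moments control every integrability question.  The summand 1 lets the energy also dominate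
  \<open>max 1 (q i)\<close>, which bounds the length of an excursion.
\<close>

definition energy :: "('n::finite) state \<Rightarrow> real" where
  "energy \<alpha> = 1 + (\<Sum>i\<in>UNIV. (real (fst \<alpha> i))\<^sup>2)"

lemma energy_ge_1: "1 \<le> energy \<alpha>"
  by (simp add: energy_def sum_nonneg)

lemma energy_nonneg: "0 \<le> energy \<alpha>"
  using energy_ge_1[of \<alpha>] by linarith

lemma lyapunov_nonneg: "0 \<le> lyapunov \<gamma> \<alpha>"
  by (simp add: lyapunov_def sum_nonneg)

lemma lyapunov_le_energy: "0 < \<gamma> \<Longrightarrow> \<gamma> \<le> 1 \<Longrightarrow> lyapunov \<gamma> \<alpha> \<le> energy \<alpha>"
  unfolding lyapunov_def energy_def
  by (intro add_increasing sum_mono nat_powr_add_one_le_square) auto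

lemma max_1_square_le_energy: "(real (max 1 (fst \<alpha> i)))\<^sup>2 \<le> energy \<alpha>"
proof -
  have "(real (fst \<alpha> i))\<^sup>2 \<le> (\<Sum>i\<in>UNIV. (real (fst \<alpha> i))\<^sup>2)"
    by (rule member_le_sum) auto
  then show ?thesis using energy_ge_1[of \<alpha>] by (auto simp: energy_def max_def)
qed

section \<open>One excursion of a sample path\<close>

text \<open>
  No sampling time in the \<open>u\<close> slots after \<open>t\<close>; unlike the length of the excursion,
  this is decided by the path up to time \<open>t + u\<close>.
\<close>

definition quiet :: "(nat \<Rightarrow> 'n state) \<Rightarrow> nat \<Rightarrow> nat \<Rightarrow> bool" where
  "quiet x t u \<longleftrightarrow> (\<forall>v\<in>{1..u}. \<not> nonLI_idle (x (t + v)))"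

lemma quiet_0 [simp]: "quiet x t 0"
  by (simp add: quiet_def)

lemma quiet_Suc: "quiet x t (Suc u) \<longleftrightarrow> quiet x t u \<and> \<not> nonLI_idle (x (t + Suc u))"
  unfolding quiet_def by (subst atLeastAtMostSuc_conv) auto

definition next_samp :: "(nat \<Rightarrow> 'n state) \<Rightarrow> nat \<Rightarrow> nat" where
  "next_samp x t = (LEAST u. u > t \<and> nonLI_idle (x u))"

text \<open>
  A single sample path, outside the null set on which a service capacity leaves its range or a
  tie-breaking choice is not idle.
\<close>

locale persistent_idle_path =
  fixes x :: "nat \<Rightarrow> 'n::finite state" and xi :: "nat \<Rightarrow> 'n"
    and a :: "nat \<Rightarrow> nat" and s :: "nat \<Rightarrow> 'n \<Rightarrow> nat" and smax :: nat
  assumes step: "x (Suc t) = next_state (xi (Suc t)) (a (Suc t)) (s (Suc t)) (x t)"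
    and s_ge: "1 \<le> s (Suc t) i" and s_le: "s (Suc t) i \<le> smax"
    and xi_idle: "idle (fst (x t)) \<noteq> {} \<Longrightarrow> xi (Suc t) \<in> idle (fst (x t))"
begin

lemma sum_s_ge: "u \<le> (\<Sum>v<u. s (Suc (t + v)) i)"
  using sum_mono[of "{..<u}" "\<lambda>_. 1" "\<lambda>v. s (Suc (t + v)) i"] s_ge by simp

lemma sum_s_le: "(\<Sum>v<u. s (Suc (t + v)) i) \<le> smax * u"
  using sum_mono[of "{..<u}" "\<lambda>v. s (Suc (t + v)) i" "\<lambda>_. smax"] s_le by (simp add: mult.commute)

end

text \<open>
  An excursion begins at time \<open>t\<close> in a state where some server other than the Last-Idle one is
  idle; it ends at the next such time.
\<close>

locale excursion_path = persistent_idle_path x xi a s smax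
  for x :: "nat \<Rightarrow> 'n::finite state" and xi :: "nat \<Rightarrow> 'n"
    and a :: "nat \<Rightarrow> nat" and s :: "nat \<Rightarrow> 'n \<Rightarrow> nat" and smax :: nat +
  fixes t :: nat and q :: "'n \<Rightarrow> nat" and j :: 'n
  assumes start: "nonLI_idle (x t)" and q: "fst (x t) = q" and j: "xi (Suc t) = j"
begin

lemma q_j: "q j = 0"
proof -
  have "idle q \<noteq> {}" using start q by (auto simp: nonLI_idle_def idle_def)
  then show ?thesis using xi_idle[of t] by (auto simp: q j idle_def)
qed

lemma other_server: "\<exists>i. i \<noteq> j"
  using start unfolding nonLI_idle_def by metis

text \<open>
  While no other server is idle, either nobody is idle and the label is kept, or \<open>j\<close> is the only
  idle server and is chosen again.
\<close>

lemma excursion_LI: "quiet x t u \<Longrightarrow> snd (x (t + Suc u)) = j"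
proof (induction u)
  case 0
  have "idle q \<noteq> {}" using q_j by (auto simp: idle_def)
  then show ?case using step[of t] by (simp add: next_state_def q j Let_def split_beta)
next
  case (Suc u)
  then have IH: "snd (x (t + Suc u)) = j" and "\<not> nonLI_idle (x (t + Suc u))"
    by (auto simp: quiet_Suc)
  then have *: "idle (fst (x (t + Suc u))) \<subseteq> {j}"
    unfolding nonLI_idle_def idle_def by blast
  show ?case
    using step[of "t + Suc u"] xi_idle[of "t + Suc u"] IH *
    by (auto simp: next_state_def Let_def split_beta)
qed

lemma fst_step: "quiet x t u \<Longrightarrow> fst (x (t + Suc u)) i
    = fst (x (t + u)) i + (if i = j then a (Suc (t + u)) else 0) - s (Suc (t + u)) i"
  using excursion_LI[of u] step[of "t + u"] by (auto simp: next_state_def Let_def split_beta)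

lemma excursion_other:
  "quiet x t u \<Longrightarrow> i \<noteq> j \<Longrightarrow> fst (x (t + Suc u)) i = q i - (\<Sum>v<Suc u. s (Suc (t + v)) i)"
proof (induction u)
  case 0
  then show ?case using fst_step[of 0] by (simp add: q)
next
  case (Suc u)
  then show ?case using fst_step[of "Suc u" i] by (simp add: quiet_Suc)
qed

lemma excursion_arrivals:
  "quiet x t u \<Longrightarrow> fst (x (t + Suc u)) j \<le> (\<Sum>v<Suc u. a (Suc (t + v)))"
proof (induction u)
  case 0
  then show ?case using fst_step[of 0 j] q_j by (simp add: q)
next
  case (Suc u)
  then show ?case using fst_step[of "Suc u" j] by (simp add: quiet_Suc)
qed

text \<open>
  A server other than \<open>j\<close> that is not yet idle has not worked off its initial queue.
\<close>

lemma quiet_bound: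
  assumes "quiet x t (Suc u)" "i \<noteq> j"
  shows "(\<Sum>v<Suc u. s (Suc (t + v)) i) < q i"
proof -
  have "fst (x (t + Suc u)) i \<noteq> 0"
    using assms excursion_LI[of u] by (auto simp: quiet_Suc nonLI_idle_def)
  then show ?thesis using excursion_other[of u i] assms by (simp add: quiet_Suc)
qed

definition T :: nat where "T = next_samp x t - t"

lemma end_of_excursion:
  shows next_samp_eq: "next_samp x t = t + T" and T_pos: "1 \<le> T"
    and T_idle: "nonLI_idle (x (t + T))" and quiet_iff: "quiet x t u \<longleftrightarrow> u < T"
proof -
  obtain i where i: "i \<noteq> j" using other_server by auto
  have ex: "\<exists>u>t. nonLI_idle (x u)"
  proof (rule ccontr)
    assume "\<not> ?thesis"
    then have "quiet x t (Suc (q i))" by (auto simp: quiet_def)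
    from quiet_bound[OF this i] sum_s_ge[where u="Suc (q i)" and t=t and i=i] show False by simp
  qed
  have nx: "next_samp x t > t \<and> nonLI_idle (x (next_samp x t))"
    unfolding next_samp_def using LeastI_ex[OF ex] .
  then show n: "next_samp x t = t + T" and "1 \<le> T" by (auto simp: T_def)
  show T: "nonLI_idle (x (t + T))" using nx n by simp
  have low: "\<not> nonLI_idle (x (t + v))" if "1 \<le> v" "v < T" for v
    using not_less_Least[of "t + v" "\<lambda>u. u > t \<and> nonLI_idle (x u)"] that n
    by (auto simp: next_samp_def)
  show "quiet x t u \<longleftrightarrow> u < T"
  proof
    assume "u < T" then show "quiet x t u" using low by (auto simp: quiet_def)
  next
    assume "quiet x t u" then show "u < T"
      using T \<open>1 \<le> T\<close> by (auto simp: quiet_def not_less[symmetric])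
  qed
qed

lemma quiet_T: "quiet x t (T - 1)" and Suc_T: "Suc (T - 1) = T"
  using T_pos by (auto simp: quiet_iff)

lemma T_le:
  assumes "i \<noteq> j"
  shows "T \<le> max 1 (q i)"
proof (cases "T = 1")
  case False
  then obtain u where u: "T = Suc (Suc u)" using T_pos by (metis Suc_T nat.exhaust One_nat_def)
  then have "quiet x t (Suc u)" by (simp add: quiet_iff)
  from quiet_bound[OF this assms] sum_s_ge[where u="Suc u" and t=t and i=i] u show ?thesis by simp
qed simp

text \<open>
  The work done before the last slot of the excursion is less than \<open>q i\<close>, and the last slot adds at
  most \<open>smax\<close>.
\<close>

lemma sum_s_T_le:
  assumes "i \<noteq> j"
  shows "(\<Sum>v<T. s (Suc (t + v)) i) \<le> q i + smax"
proof (cases "T = 1")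
  case False
  then obtain u where u: "T = Suc (Suc u)" using T_pos by (metis Suc_T nat.exhaust One_nat_def)
  then have "quiet x t (Suc u)" by (simp add: quiet_iff)
  from quiet_bound[OF this assms] show ?thesis using s_le[of "t + Suc u" i] u by simp
qed (use s_le[of t i] in simp)

lemma x_T_other: "i \<noteq> j \<Longrightarrow> fst (x (t + T)) i = q i - (\<Sum>v<T. s (Suc (t + v)) i)"
  using excursion_other[OF quiet_T, of i] Suc_T by simp

lemma x_T_arrivals: "fst (x (t + T)) j \<le> (\<Sum>v<T. a (Suc (t + v)))"
  using excursion_arrivals[OF quiet_T] Suc_T by simp

text \<open>
  The excursion ends because some server other than \<open>j\<close> has run empty, which takes at least
  \<open>q i / smax\<close> slots.  This makes \<open>T\<close> comparable with the shortest queue.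
\<close>

lemma queue_emptied: "\<exists>i. i \<noteq> j \<and> q i \<le> smax * T"
proof -
  have "snd (x (t + T)) = j" using excursion_LI[OF quiet_T] Suc_T by simp
  then obtain i where i: "i \<noteq> j" "fst (x (t + T)) i = 0"
    using T_idle by (auto simp: nonLI_idle_def)
  then have "q i \<le> (\<Sum>v<T. s (Suc (t + v)) i)" using x_T_other by simp
  then show ?thesis using i sum_s_le[where u=T and t=t and i=i] by (intro exI[of _ i]) simp
qed

text \<open>
  The left-hand side is \<open>W T\<close> for a process \<open>W\<close> with \<open>W 0 = c\<close>, and the summands bound its increments
  before the end of the excursion.  Since \<open>quiet\<close> is known at the beginning of the slot, each summand can
  later be averaged over the inputs of that slot alone.  The sum may run to any \<open>N \<ge> T\<close> because the
  summands vanish after the excursion, so \<open>N\<close> can be taken deterministic.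
\<close>

lemma smooth_queue_telescope:
  assumes c: "0 < c" and N: "T \<le> N"
  shows "sqrt ((real (fst (x (t + T)) j))\<^sup>2 + c\<^sup>2)
      - (\<Sum>i\<in>-{j}. \<Sum>v<T. real (s (Suc (t + v)) i)) + \<delta> * real T
    \<le> c + (\<Sum>u<N. of_bool (quiet x t u) *
        (real (fst (x (t + u)) j) / sqrt ((real (fst (x (t + u)) j))\<^sup>2 + c\<^sup>2)
            * (real (a (Suc (t + u))) - real (s (Suc (t + u)) j))
          + ((real (a (Suc (t + u))))\<^sup>2 + (real smax)\<^sup>2) / (2 * c)
          - (\<Sum>i\<in>-{j}. real (s (Suc (t + u)) i)) + \<delta>))"
    (is "_ \<le> c + (\<Sum>u<N. of_bool (quiet x t u) * ?d u)")
proof -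
  define W where "W u = sqrt ((real (fst (x (t + u)) j))\<^sup>2 + c\<^sup>2)
      - (\<Sum>i\<in>-{j}. \<Sum>v<u. real (s (Suc (t + v)) i)) + \<delta> * real u" for u
  have inc: "W (Suc u) \<le> W u + ?d u" if "quiet x t u" for u
  proof -
    define y where "y = fst (x (t + Suc u)) j"
    have y: "y = fst (x (t + u)) j + a (Suc (t + u)) - s (Suc (t + u)) j"
      using fst_step[OF that, of j] by (simp add: y_def)
    have "(real y)\<^sup>2 \<le> (real (fst (x (t + u)) j) + real (a (Suc (t + u))) - real (s (Suc (t + u)) j))\<^sup>2"
      unfolding y by (cases "s (Suc (t + u)) j \<le> fst (x (t + u)) j + a (Suc (t + u))")
        (simp_all add: of_nat_diff)
    from smooth_abs_step[OF c _ _ _ _ _ this, of "real smax"] s_le[of "t + u" j]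
    show ?thesis unfolding W_def y_def[symmetric]
      by (simp add: sum.distrib algebra_simps)
  qed
  have "W u \<le> W 0 + (\<Sum>v<u. ?d v)" if "u \<le> T" for u
    using that
  proof (induction u)
    case (Suc u)
    then have "quiet x t u" by (simp add: quiet_iff)
    from inc[OF this] Suc show ?case by simp
  qed simp
  from this[of T] have "W T \<le> c + (\<Sum>v<T. ?d v)"
    using c q_j by (simp add: W_def q)
  also have "(\<Sum>v<T. ?d v) = (\<Sum>u<N. of_bool (quiet x t u) * ?d u)"
    by (rule sum.mono_neutral_cong_left) (use N in \<open>auto simp: quiet_iff\<close>)
  finally show ?thesis unfolding W_def .
qed

lemma lyapunov_drop:
  assumes "0 < \<gamma>"
  shows "lyapunov \<gamma> (x (t + T)) - lyapunov \<gamma> (x t)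
    \<le> real (fst (x (t + T)) j) powr (1 + \<gamma>)
      - (\<Sum>i\<in>-{j}. real (q i) powr \<gamma> * real (min (q i) (\<Sum>v<T. s (Suc (t + v)) i)))"
proof -
  have "(\<Sum>i\<in>-{j}. real (fst (x (t + T)) i) powr (1 + \<gamma>))
    \<le> (\<Sum>i\<in>-{j}. real (q i) powr (1 + \<gamma>)
        - real (q i) powr \<gamma> * real (min (q i) (\<Sum>v<T. s (Suc (t + v)) i)))"
  proof (rule sum_mono)
    fix i assume "i \<in> -{j}"
    then have x: "fst (x (t + T)) i = q i - (\<Sum>v<T. s (Suc (t + v)) i)" using x_T_other by simp
    then have "real (q i) - real (fst (x (t + T)) i) = real (min (q i) (\<Sum>v<T. s (Suc (t + v)) i))"
      by (auto simp: min_def of_nat_diff)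
    with powr_add_one_drop[of "real (fst (x (t + T)) i)" "real (q i)" \<gamma>] x assms
    show "real (fst (x (t + T)) i) powr (1 + \<gamma>) \<le> real (q i) powr (1 + \<gamma>)
        - real (q i) powr \<gamma> * real (min (q i) (\<Sum>v<T. s (Suc (t + v)) i))"
      by simp
  qed
  moreover have "lyapunov \<gamma> (x t) = (\<Sum>i\<in>-{j}. real (q i) powr (1 + \<gamma>))"
    unfolding lyapunov_def q
    by (rule sum.mono_neutral_right) (use q_j assms in auto)
  moreover have "lyapunov \<gamma> (x (t + T)) = real (fst (x (t + T)) j) powr (1 + \<gamma>)
      + (\<Sum>i\<in>-{j}. real (fst (x (t + T)) i) powr (1 + \<gamma>))"
    unfolding lyapunov_def by (subst sum.remove[of _ j]) (auto simp: Compl_eq_Diff_UNIV)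
  ultimately show ?thesis by (simp add: sum_subtractf)
qed

lemma x_T_arrivals_le:
  assumes "T \<le> N"
  shows "real (fst (x (t + T)) j) \<le> (\<Sum>u<N. real (a (Suc (t + u))))"
proof -
  have "fst (x (t + T)) j \<le> (\<Sum>u<N. a (Suc (t + u)))"
    using x_T_arrivals sum_mono2[of "{..<N}" "{..<T}" "\<lambda>u. a (Suc (t + u))"] assms by simp
  then show ?thesis by (metis of_nat_le_iff of_nat_sum)
qed

text \<open>
  A short queue bounds the excursion by \<open>N\<close> slots.  Queue \<open>k\<close> is too long to run empty in that time,
  so it loses at least \<open>T\<close> jobs, each worth \<open>R powr \<gamma>\<close>.
\<close>

lemma drift_some_queue_short:
  assumes \<gamma>: "0 < \<gamma>" "\<gamma> \<le> 1" and i: "i \<noteq> j" "q i \<le> N" and N: "1 \<le> N"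
    and R: "0 < R" "smax * N \<le> R" "R \<le> q k"
    and \<epsilon>: "\<epsilon> + (real N)\<^sup>2 * A2 \<le> real R powr \<gamma>" and A2: "0 \<le> A2"
  shows "lyapunov \<gamma> (x (t + T)) - lyapunov \<gamma> (x t) + \<epsilon> * real T
    \<le> (\<Sum>u<N. real (a (Suc (t + u))))\<^sup>2 - (real N)\<^sup>2 * A2"
proof -
  let ?S = "\<lambda>i. \<Sum>v<T. s (Suc (t + v)) i"
  have TN: "T \<le> N" using T_le[OF i(1)] i(2) N by simp
  have k: "k \<noteq> j" using R q_j by auto
  have "real (fst (x (t + T)) j) powr (1 + \<gamma>) \<le> (real (fst (x (t + T)) j))\<^sup>2"
    by (rule nat_powr_add_one_le_square[OF \<gamma>])
  also have "\<dots> \<le> (\<Sum>u<N. real (a (Suc (t + u))))\<^sup>2"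
    by (intro power_mono x_T_arrivals_le TN) simp
  finally have 1: "real (fst (x (t + T)) j) powr (1 + \<gamma>) \<le> (\<Sum>u<N. real (a (Suc (t + u))))\<^sup>2" .
  have "?S k \<le> smax * T" by (rule sum_s_le)
  also have "\<dots> \<le> smax * N" using TN by simp
  finally have "min (q k) (?S k) = ?S k" using R by simp
  moreover have "T \<le> ?S k" by (rule sum_s_ge)
  ultimately have "real T \<le> real (min (q k) (?S k))" by (metis of_nat_le_iff)
  then have "real R powr \<gamma> * real T \<le> real (q k) powr \<gamma> * real (min (q k) (?S k))"
    using R \<gamma> by (intro mult_mono powr_mono2) auto
  also have "\<dots> \<le> (\<Sum>i\<in>-{j}. real (q i) powr \<gamma> * real (min (q i) (?S i)))"
    using k by (intro member_le_sum) auto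
  finally have 2: "real R powr \<gamma> * real T \<le> (\<Sum>i\<in>-{j}. real (q i) powr \<gamma> * real (min (q i) (?S i)))" .
  have "(real N)\<^sup>2 * A2 * 1 \<le> (real N)\<^sup>2 * A2 * real T"
    using A2 T_pos by (intro mult_left_mono) auto
  moreover have "(\<epsilon> + (real N)\<^sup>2 * A2) * real T \<le> real R powr \<gamma> * real T"
    using \<epsilon> by (intro mult_right_mono) auto
  ultimately show ?thesis using lyapunov_drop[OF \<gamma>(1)] 1 2 by (simp add: algebra_simps)
qed

text \<open>
  Averaged over the inputs, both terms on the right are at most 0.  The other losses, namely \<open>c\<close>, the overshoot of at
  most \<open>smax\<close> at each server, the amount \<open>\<gamma> m A2\<close> set aside for the quadratic term and \<open>\<epsilon> T\<close>, are paid
  from \<open>\<delta> T\<close>, which is possible because \<open>m \<le> smax T\<close> and \<open>m\<close> is large.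
\<close>

lemma drift_all_queues_long:
  fixes m :: nat
  assumes \<gamma>: "0 < \<gamma>" "\<gamma> \<le> 1" and c: "0 < c" and \<epsilon>: "0 \<le> \<epsilon>" "\<epsilon> \<le> \<delta> / 4"
    and m: "1 \<le> m" "\<And>i. i \<noteq> j \<Longrightarrow> m \<le> q i" "\<exists>i. i \<noteq> j \<and> q i = m"
    and A2: "\<gamma> * A2 * real smax \<le> \<delta> / 4" "0 \<le> A2"
    and large: "2 * real smax * (c + real CARD('n) * real smax) \<le> \<delta> * real m"
  shows "lyapunov \<gamma> (x (t + T)) - lyapunov \<gamma> (x t) + \<epsilon> * real T
    \<le> real m powr \<gamma> * ((\<Sum>u<m. of_bool (quiet x t u) *
        (real (fst (x (t + u)) j) / sqrt ((real (fst (x (t + u)) j))\<^sup>2 + c\<^sup>2)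
            * (real (a (Suc (t + u))) - real (s (Suc (t + u)) j))
          + ((real (a (Suc (t + u))))\<^sup>2 + (real smax)\<^sup>2) / (2 * c)
          - (\<Sum>i\<in>-{j}. real (s (Suc (t + u)) i)) + \<delta>))
        + \<gamma> * ((\<Sum>u<m. real (a (Suc (t + u))))\<^sup>2 / real m - real m * A2))"
    (is "_ \<le> _ * (?Z + _ * (?a\<^sup>2 / _ - _))")
proof -
  let ?S = "\<lambda>i. \<Sum>v<T. s (Suc (t + v)) i"
  define y where "y = real (fst (x (t + T)) j)"
  define p where "p = real m powr \<gamma>"
  have p1: "1 \<le> p" using m \<gamma> unfolding p_def by (intro ge_one_powr_ge_zero) auto
  have Tm: "T \<le> m" using m T_le by fastforce
  have mT: "real m \<le> real smax * real T"
    using queue_emptied m(2) by (metis le_trans of_nat_le_iff of_nat_mult)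
  have smax: "0 < smax" using s_ge[of 0 j] s_le[of 0 j] by simp
  have y: "0 \<le> y" "y \<le> ?a" using x_T_arrivals_le[OF Tm] by (auto simp: y_def)
  have "y powr (1 + \<gamma>) \<le> p * (y + \<gamma> * y\<^sup>2 / real m)"
    unfolding p_def using m \<gamma> y by (intro powr_add_one_le_quadratic) auto
  also have "\<dots> \<le> p * (sqrt (y\<^sup>2 + c\<^sup>2) + \<gamma> * (?a\<^sup>2 / real m))"
  proof (intro mult_left_mono add_mono)
    show "y \<le> sqrt (y\<^sup>2 + c\<^sup>2)" by (intro real_le_rsqrt) simp
    have "y\<^sup>2 / real m \<le> ?a\<^sup>2 / real m" using y by (intro divide_right_mono power_mono) auto
    then have "\<gamma> * (y\<^sup>2 / real m) \<le> \<gamma> * (?a\<^sup>2 / real m)" using \<gamma> by (intro mult_left_mono) auto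
    then show "\<gamma> * y\<^sup>2 / real m \<le> \<gamma> * (?a\<^sup>2 / real m)" by simp
  qed (use p1 in simp)
  finally have 1: "y powr (1 + \<gamma>) \<le> p * (sqrt (y\<^sup>2 + c\<^sup>2) + \<gamma> * (?a\<^sup>2 / real m))" .
  have "p * ((\<Sum>i\<in>-{j}. real (?S i)) - real CARD('n) * real smax)
    \<le> p * (\<Sum>i\<in>-{j}. real (min (q i) (?S i)))"
  proof (rule mult_left_mono)
    have "real (?S i) - real smax \<le> real (min (q i) (?S i))" if "i \<in> -{j}" for i
      using sum_s_T_le[of i] that by (auto simp: min_def simp flip: of_nat_sum)
    then have "(\<Sum>i\<in>-{j}. real (?S i) - real smax) \<le> (\<Sum>i\<in>-{j}. real (min (q i) (?S i)))"
      by (rule sum_mono)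
    moreover have "(\<Sum>i\<in>-{j}. real smax) \<le> (\<Sum>i\<in>(UNIV :: 'n set). real smax)"
      by (rule sum_mono2) auto
    ultimately show "(\<Sum>i\<in>-{j}. real (?S i)) - real CARD('n) * real smax
        \<le> (\<Sum>i\<in>-{j}. real (min (q i) (?S i)))"
      by (simp add: sum_subtractf)
  qed (use p1 in simp)
  also have "p * (\<Sum>i\<in>-{j}. real (min (q i) (?S i)))
      \<le> (\<Sum>i\<in>-{j}. real (q i) powr \<gamma> * real (min (q i) (?S i)))"
    unfolding sum_distrib_left p_def using m \<gamma> by (intro sum_mono mult_right_mono powr_mono2) auto
  finally have 2: "p * ((\<Sum>i\<in>-{j}. real (?S i)) - real CARD('n) * real smax)
      \<le> (\<Sum>i\<in>-{j}. real (q i) powr \<gamma> * real (min (q i) (?S i)))" .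
  have "p * (sqrt (y\<^sup>2 + c\<^sup>2) - (\<Sum>i\<in>-{j}. real (?S i)) + \<delta> * real T) \<le> p * (c + ?Z)"
    using smooth_queue_telescope[OF c Tm, of \<delta>] p1 by (intro mult_left_mono) (auto simp: y_def)
  moreover have "\<epsilon> * real T \<le> p * (\<epsilon> * real T)"
    using p1 \<epsilon>(1) mult_right_mono[of 1 p "\<epsilon> * real T"] by simp
  moreover have "p * (c + real CARD('n) * real smax + \<gamma> * A2 * real m + \<epsilon> * real T - \<delta> * real T) \<le> 0"
  proof (rule mult_nonneg_nonpos)
    have d: "0 \<le> \<delta>" using \<epsilon> by simp
    have "2 * real smax * (c + real CARD('n) * real smax) \<le> \<delta> * (real smax * real T)"
      using large mult_left_mono[OF mT d] by simp
    also have "\<dots> = 2 * real smax * (\<delta> / 2 * real T)" by simp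
    finally have "c + real CARD('n) * real smax \<le> \<delta> / 2 * real T"
      by (rule mult_left_le_imp_le) (use smax in simp)
    moreover have "\<gamma> * A2 * real m \<le> \<gamma> * A2 * (real smax * real T)"
      using mT \<gamma> A2 by (intro mult_left_mono) auto
    moreover have "\<gamma> * A2 * real smax * real T \<le> \<delta> / 4 * real T"
      using A2 by (intro mult_right_mono) auto
    moreover have "\<epsilon> * real T \<le> \<delta> / 4 * real T"
      using \<epsilon> by (intro mult_right_mono) auto
    ultimately show "c + real CARD('n) * real smax + \<gamma> * A2 * real m + \<epsilon> * real T - \<delta> * real T \<le> 0"
      by (simp add: algebra_simps)
  qed (use p1 in simp)
  ultimately show ?thesis
    using lyapunov_drop[OF \<gamma>(1)] 1 2 unfolding p_def[symmetric] y_def[symmetric]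
    by (simp add: algebra_simps)
qed

lemma energy_step:
  assumes "T \<le> N"
  shows "energy (x (t + T)) \<le> energy (x t) + (\<Sum>u<N. real (a (Suc (t + u))))\<^sup>2"
proof -
  have "(\<Sum>i\<in>-{j}. (real (fst (x (t + T)) i))\<^sup>2) \<le> (\<Sum>i\<in>-{j}. (real (fst (x t) i))\<^sup>2)"
    by (intro sum_mono power_mono) (auto simp: x_T_other q)
  moreover have "(\<Sum>i\<in>UNIV. (real (fst (x t) i))\<^sup>2) = (\<Sum>i\<in>-{j}. (real (fst (x t) i))\<^sup>2)"
    by (rule sum.mono_neutral_right) (auto simp: q_j q)
  moreover have "(\<Sum>i\<in>UNIV. (real (fst (x (t + T)) i))\<^sup>2) = (real (fst (x (t + T)) j))\<^sup>2
      + (\<Sum>i\<in>-{j}. (real (fst (x (t + T)) i))\<^sup>2)"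
    by (subst sum.remove[of _ j]) (auto simp: Compl_eq_Diff_UNIV)
  moreover have "(real (fst (x (t + T)) j))\<^sup>2 \<le> (\<Sum>u<N. real (a (Suc (t + u))))\<^sup>2"
    by (intro power_mono x_T_arrivals_le assms) simp
  ultimately show ?thesis unfolding energy_def by linarith
qed

end

section \<open>Integrals over countable partitions, conditional measures and conditional expectations\<close>

lemma nn_integral_countable_partition:
  fixes \<kappa> :: "'a \<Rightarrow> 'c::countable" and f :: "'a \<Rightarrow> ennreal"
  assumes [measurable]: "f \<in> borel_measurable M" "\<kappa> \<in> measurable M (count_space UNIV)"
  shows "(\<integral>\<^sup>+\<omega>. f \<omega> \<partial>M) = (\<integral>\<^sup>+c. (\<integral>\<^sup>+\<omega>. f \<omega> * indicator {c} (\<kappa> \<omega>) \<partial>M) \<partial>count_space UNIV)"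
proof -
  have "(\<integral>\<^sup>+c. f \<omega> * indicator {c} (\<kappa> \<omega>) \<partial>count_space UNIV) = f \<omega>" for \<omega>
  proof -
    have "(\<integral>\<^sup>+c. f \<omega> * indicator {c} (\<kappa> \<omega>) \<partial>count_space UNIV)
        = (\<Sum>c\<in>{\<kappa> \<omega>}. f \<omega> * indicator {c} (\<kappa> \<omega>))"
      by (rule nn_integral_count_space') auto
    then show ?thesis by simp
  qed
  then have "(\<integral>\<^sup>+\<omega>. f \<omega> \<partial>M) = (\<integral>\<^sup>+\<omega>. (\<integral>\<^sup>+c. f \<omega> * indicator {c} (\<kappa> \<omega>) \<partial>count_space UNIV) \<partial>M)"
    by simp
  also have "\<dots> = (\<integral>\<^sup>+c. (\<integral>\<^sup>+\<omega>. f \<omega> * indicator {c} (\<kappa> \<omega>) \<partial>M) \<partial>count_space UNIV)"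
    by (rule nn_integral_count_space_nn_integral) auto
  finally show ?thesis .
qed

lemma integral_nonpos_countable_partition:
  fixes \<kappa> :: "'a \<Rightarrow> 'c::countable" and f :: "'a \<Rightarrow> real"
  assumes f[measurable]: "integrable M f" and [measurable]: "\<kappa> \<in> measurable M (count_space UNIV)"
    and le: "\<And>c. (\<integral>\<omega>. f \<omega> * indicator {c} (\<kappa> \<omega>) \<partial>M) \<le> 0"
  shows "(\<integral>\<omega>. f \<omega> \<partial>M) \<le> 0"
proof -
  have piece: "(\<integral>\<^sup>+\<omega>. ennreal (f \<omega>) * indicator {c} (\<kappa> \<omega>) \<partial>M)
      \<le> (\<integral>\<^sup>+\<omega>. ennreal (- f \<omega>) * indicator {c} (\<kappa> \<omega>) \<partial>M)" for c
  proof -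
    let ?g = "\<lambda>\<omega>. f \<omega> * indicator {c} (\<kappa> \<omega>)"
    have g: "integrable M ?g"
      by (rule Bochner_Integration.integrable_bound[OF f]) (auto simp: indicator_def)
    have "(\<integral>\<^sup>+\<omega>. ennreal (f \<omega>) * indicator {c} (\<kappa> \<omega>) \<partial>M) = (\<integral>\<^sup>+\<omega>. ennreal (?g \<omega>) \<partial>M)"
      by (intro nn_integral_cong) (auto simp: indicator_def)
    moreover have "(\<integral>\<^sup>+\<omega>. ennreal (- f \<omega>) * indicator {c} (\<kappa> \<omega>) \<partial>M) = (\<integral>\<^sup>+\<omega>. ennreal (- ?g \<omega>) \<partial>M)"
      by (intro nn_integral_cong) (auto simp: indicator_def)
    moreover have "(\<integral>\<^sup>+\<omega>. ennreal (?g \<omega>) \<partial>M) \<noteq> \<infinity>" "(\<integral>\<^sup>+\<omega>. ennreal (- ?g \<omega>) \<partial>M) \<noteq> \<infinity>"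
      using g unfolding real_integrable_def by auto
    ultimately show ?thesis
      using le[of c] real_lebesgue_integral_def[OF g]
      by (smt (verit) ennreal_enn2real ennreal_leI infinity_ennreal_def less_top)
  qed
  have "(\<integral>\<^sup>+\<omega>. ennreal (f \<omega>) \<partial>M) \<le> (\<integral>\<^sup>+\<omega>. ennreal (- f \<omega>) \<partial>M)"
    by (subst (1 2) nn_integral_countable_partition[where \<kappa>=\<kappa>]) (auto intro!: nn_integral_mono piece)
  moreover have "(\<integral>\<^sup>+\<omega>. ennreal (f \<omega>) \<partial>M) \<noteq> \<infinity>" "(\<integral>\<^sup>+\<omega>. ennreal (- f \<omega>) \<partial>M) \<noteq> \<infinity>"
    using f unfolding real_integrable_def by auto
  ultimately show ?thesis
    unfolding real_lebesgue_integral_def[OF f] by (simp add: enn2real_mono less_top)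
qed

lemma (in prob_space)
  fixes f :: "'a \<Rightarrow> real"
  assumes S: "S \<in> events" "0 < prob S" and f: "f \<in> borel_measurable M"
  shows integrable_uniform_measure_iff:
      "integrable (uniform_measure M S) f \<longleftrightarrow> integrable M (\<lambda>\<omega>. indicator S \<omega> * f \<omega>)"
    and integral_uniform_measure:
      "integral\<^sup>L (uniform_measure M S) f = (\<integral>\<omega>. indicator S \<omega> * f \<omega> \<partial>M) / prob S"
proof -
  have eq: "uniform_measure M S = density M (\<lambda>\<omega>. ennreal (indicator S \<omega> / prob S))"
    unfolding uniform_measure_def
  proof (rule arg_cong[where f="density M"], rule ext)
    fix \<omega> show "indicator S \<omega> / emeasure M S = ennreal (indicator S \<omega> / prob S)"
      using S divide_ennreal[of 1 "prob S"] by (simp add: emeasure_eq_measure indicator_def)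
  qed
  note [measurable] = S(1) f
  have *: "(indicator S \<omega> / prob S) *\<^sub>R f \<omega> = (indicator S \<omega> * f \<omega>) * inverse (prob S)" for \<omega>
    by (simp add: divide_inverse)
  have "integrable (density M (\<lambda>\<omega>. ennreal (indicator S \<omega> / prob S))) f
      \<longleftrightarrow> integrable M (\<lambda>\<omega>. (indicator S \<omega> / prob S) *\<^sub>R f \<omega>)"
    by (rule integrable_density) auto
  then show "integrable (uniform_measure M S) f \<longleftrightarrow> integrable M (\<lambda>\<omega>. indicator S \<omega> * f \<omega>)"
    unfolding eq * using S by simp
  have "integral\<^sup>L (density M (\<lambda>\<omega>. ennreal (indicator S \<omega> / prob S))) f
      = (\<integral>\<omega>. (indicator S \<omega> / prob S) *\<^sub>R f \<omega> \<partial>M)"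
    by (rule integral_density) auto
  then show "integral\<^sup>L (uniform_measure M S) f = (\<integral>\<omega>. indicator S \<omega> * f \<omega> \<partial>M) / prob S"
    unfolding eq * by (simp add: divide_inverse)
qed

lemma (in sigma_finite_subalgebra) real_cond_exp_nonposI:
  assumes f: "integrable M f"
    and le: "\<And>B. B \<in> sets F \<Longrightarrow> (\<integral>x\<in>B. f x \<partial>M) \<le> 0"
  shows "AE x in M. real_cond_exp M F f x \<le> 0"
proof -
  let ?h = "real_cond_exp M F f"
  define B where "B = {x \<in> space F. 0 < ?h x}"
  have B: "B \<in> sets F" unfolding B_def by measurable
  have BM: "B \<in> sets M" using B subalg by (auto simp: subalgebra_def)
  have int: "integrable M (\<lambda>x. indicator B x * ?h x)"
    using integrable_mult_indicator[OF BM real_cond_exp_int(1)[OF f]] by simp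
  have nn: "AE x in M. 0 \<le> indicator B x * ?h x"
    by (rule AE_I2) (auto simp: B_def indicator_def)
  have "(\<integral>x. indicator B x * ?h x \<partial>M) \<le> 0"
    using le[OF B] unfolding real_cond_exp_intA[OF f B] by (simp add: set_lebesgue_integral_def)
  moreover have "0 \<le> (\<integral>x. indicator B x * ?h x \<partial>M)" by (rule integral_nonneg_AE[OF nn])
  ultimately have "AE x in M. indicator B x * ?h x = 0"
    using integral_nonneg_eq_0_iff_AE[OF int nn] by simp
  then show ?thesis
    using AE_space
  proof eventually_elim
    case (elim x)
    then show ?case using subalg by (auto simp: B_def indicator_def subalgebra_def not_less split: if_splits)
  qed
qed

section \<open>Histories and their independence of the next inputs\<close>

context persistent_idle
begin

definition inputs :: "nat \<Rightarrow> 'w \<Rightarrow> nat \<times> ('n \<Rightarrow> nat)" where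
  "inputs t \<omega> = (a t \<omega>, \<lambda>i. s i t \<omega>)"

text \<open>
  Everything that has been decided when the tie-breaking server for slot \<open>t + 1\<close> is known
  but the inputs of that slot are not.
\<close>

definition hist :: "nat \<Rightarrow> 'w \<Rightarrow> 'n state \<times> (nat \<times> ('n \<Rightarrow> nat)) list \<times> 'n list" where
  "hist t \<omega> = (X 0 \<omega>, map (\<lambda>u. inputs u \<omega>) [1..<Suc t], map (\<lambda>u. \<xi> u \<omega>) [1..<Suc (Suc t)])"

lemma inputs_indep_hist:
  "indep_rv (count_space UNIV) (inputs (Suc t)) (count_space UNIV) (hist t)"
  using inputs_indep_past[of "Suc t"] unfolding inputs_def[abs_def] hist_def[abs_def] by simp

lemma measurable_hist [measurable]: "hist t \<in> measurable M (count_space UNIV)"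
  and measurable_inputs [measurable]: "inputs (Suc t) \<in> measurable M (count_space UNIV)"
  using inputs_indep_hist[of t] by (auto simp: indep_rv_def)

text \<open>
  For discrete variables this is measurability with respect to the \<open>\<sigma>\<close>-algebra of the history, because
  histories take countably many values; in this form it is checked pointwise.
\<close>

definition known :: "nat \<Rightarrow> ('w \<Rightarrow> 'b) \<Rightarrow> bool" where
  "known t f \<longleftrightarrow> (\<forall>\<omega>\<in>space M. \<forall>\<omega>'\<in>space M. hist t \<omega> = hist t \<omega>' \<longrightarrow> f \<omega> = f \<omega>')"

lemma knownD: "known t f \<Longrightarrow> hist t \<omega> = hist t \<omega>' \<Longrightarrow> \<omega> \<in> space M \<Longrightarrow> \<omega>' \<in> space M \<Longrightarrow> f \<omega> = f \<omega>'"
  unfolding known_def by blast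

lemma known_factor:
  assumes "known t f"
  obtains g where "\<And>\<omega>. \<omega> \<in> space M \<Longrightarrow> f \<omega> = g (hist t \<omega>)"
proof -
  have "\<exists>y. \<forall>\<omega>\<in>space M. hist t \<omega> = h \<longrightarrow> f \<omega> = y" for h
  proof (cases "\<exists>\<omega>'\<in>space M. hist t \<omega>' = h")
    case True
    then obtain \<omega>' where w: "\<omega>' \<in> space M" "hist t \<omega>' = h" by blast
    show ?thesis
    proof (rule exI[of _ "f \<omega>'"], intro ballI impI)
      fix \<omega> assume "\<omega> \<in> space M" "hist t \<omega> = h"
      then show "f \<omega> = f \<omega>'" by (intro knownD[OF assms]) (use w in simp_all)
    qed
  qed blast
  then have "\<exists>g. \<forall>h. \<forall>\<omega>\<in>space M. hist t \<omega> = h \<longrightarrow> f \<omega> = g h"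
    by (intro choice) blast
  then obtain g where "\<forall>h. \<forall>\<omega>\<in>space M. hist t \<omega> = h \<longrightarrow> f \<omega> = g h" ..
  then show thesis by (intro that[of g]) blast
qed

lemma hist_mono:
  assumes eq: "hist v \<omega> = hist v \<omega>'" and le: "u \<le> v"
  shows "hist u \<omega> = hist u \<omega>'"
proof -
  have "\<forall>k\<in>{1..<Suc v}. inputs k \<omega> = inputs k \<omega>'" "\<forall>k\<in>{1..<Suc (Suc v)}. \<xi> k \<omega> = \<xi> k \<omega>'"
    "X 0 \<omega> = X 0 \<omega>'"
    using eq unfolding hist_def prod.inject map_eq_conv set_upt by blast+
  then show ?thesis
    unfolding hist_def prod.inject map_eq_conv set_upt
    by (intro conjI ballI) (metis atLeastLessThan_iff le Suc_le_mono less_le_trans)+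
qed

lemma known_mono:
  assumes "known u f" "u \<le> v"
  shows "known v f"
  unfolding known_def
proof (intro ballI impI)
  fix \<omega> \<omega>' assume w: "\<omega> \<in> space M" "\<omega>' \<in> space M" "hist v \<omega> = hist v \<omega>'"
  show "f \<omega> = f \<omega>'"
    by (rule knownD[OF assms(1) hist_mono[OF w(3) assms(2)] w(1,2)])
qed

lemma histD:
  assumes "hist t \<omega> = hist t \<omega>'"
  shows "X 0 \<omega> = X 0 \<omega>'"
    and "1 \<le> u \<Longrightarrow> u \<le> t \<Longrightarrow> inputs u \<omega> = inputs u \<omega>'"
    and "1 \<le> u \<Longrightarrow> u \<le> Suc t \<Longrightarrow> \<xi> u \<omega> = \<xi> u \<omega>'"
proof -
  have *: "\<forall>k\<in>{1..<Suc t}. inputs k \<omega> = inputs k \<omega>'" "\<forall>k\<in>{1..<Suc (Suc t)}. \<xi> k \<omega> = \<xi> k \<omega>'"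
    "X 0 \<omega> = X 0 \<omega>'"
    using assms unfolding hist_def prod.inject map_eq_conv set_upt by blast+
  show "X 0 \<omega> = X 0 \<omega>'" by (rule *(3))
  show "inputs u \<omega> = inputs u \<omega>'" if "1 \<le> u" "u \<le> t"
    using bspec[OF *(1), of u] that by simp
  show "\<xi> u \<omega> = \<xi> u \<omega>'" if "1 \<le> u" "u \<le> Suc t"
    using bspec[OF *(2), of u] that by simp
qed

lemma known_inputs: "1 \<le> u \<Longrightarrow> u \<le> t \<Longrightarrow> known t (inputs u)"
  unfolding known_def by (intro ballI impI histD)

lemma known_xi: "1 \<le> u \<Longrightarrow> u \<le> Suc t \<Longrightarrow> known t (\<xi> u)"
  unfolding known_def by (intro ballI impI histD)

lemma known_X: "u \<le> t \<Longrightarrow> known t (X u)"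
proof (induction u)
  case 0
  then show ?case unfolding known_def by (intro ballI impI histD)
next
  case (Suc u)
  have "known t (X u)" "known t (inputs (Suc u))" "known t (\<xi> (Suc u))"
    using Suc by (auto intro: known_inputs known_xi)
  note known = this
  show ?case
    unfolding known_def
  proof (intro ballI impI)
    fix \<omega> \<omega>' assume w: "\<omega> \<in> space M" "\<omega>' \<in> space M" "hist t \<omega> = hist t \<omega>'"
    have "X u \<omega> = X u \<omega>'" "inputs (Suc u) \<omega> = inputs (Suc u) \<omega>'" "\<xi> (Suc u) \<omega> = \<xi> (Suc u) \<omega>'"
      using known w by (blast dest: knownD)+
    then show "X (Suc u) \<omega> = X (Suc u) \<omega>'"
      using w X_recursion[of "Suc u" \<omega>] X_recursion[of "Suc u" \<omega>'] by (simp add: inputs_def)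
  qed
qed

lemma known_fun: "known t f \<Longrightarrow> known t (\<lambda>\<omega>. g (f \<omega>))"
  unfolding known_def[of t "\<lambda>\<omega>. g (f \<omega>)"]
  by (intro ballI impI arg_cong[where f=g]) (rule knownD)

lemma known_fun2: "known t f \<Longrightarrow> known t f' \<Longrightarrow> known t (\<lambda>\<omega>. h (f \<omega>) (f' \<omega>))"
  unfolding known_def[of t "\<lambda>\<omega>. h (f \<omega>) (f' \<omega>)"]
  by (intro ballI impI arg_cong2[where f=h]; rule knownD)

lemma known_measurable:
  assumes "known t f"
  shows "f \<in> measurable (vimage_algebra (space M) (hist t) (count_space UNIV)) (count_space UNIV)"
    and "f \<in> measurable M (count_space UNIV)"
proof -
  obtain g where g: "\<And>\<omega>. \<omega> \<in> space M \<Longrightarrow> f \<omega> = g (hist t \<omega>)" using known_factor[OF assms] by blast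
  have *: "(\<lambda>\<omega>. g (hist t \<omega>)) \<in> measurable N (count_space UNIV)"
    if "hist t \<in> measurable N (count_space UNIV)" for N
    by (rule measurable_compose[OF that]) simp
  show "f \<in> measurable (vimage_algebra (space M) (hist t) (count_space UNIV)) (count_space UNIV)"
    by (subst measurable_cong[OF g]) (auto intro!: * measurable_vimage_algebra1)
  show "f \<in> measurable M (count_space UNIV)"
    by (subst measurable_cong[OF g]) (auto intro!: *)
qed

lemma known_borel: "known t (f :: _ \<Rightarrow> real) \<Longrightarrow> f \<in> borel_measurable M"
  using measurable_compose[OF known_measurable(2), of t f "\<lambda>x. x" borel] by simp

lemma measurable_X [measurable]: "X t \<in> measurable M (count_space UNIV)"
  by (rule known_measurable(2)[OF known_X[OF order_refl]])

lemma measurable_xi_Suc [measurable]: "\<xi> (Suc t) \<in> measurable M (count_space UNIV)"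
  by (rule xi_measurable) simp

text \<open>
  The form in which the independence of the inputs from the past is used: one slot at a time.
\<close>

lemma indep_var_inputs_known:
  fixes f :: "nat \<times> ('n \<Rightarrow> nat) \<Rightarrow> real" and h :: "'w \<Rightarrow> real"
  assumes h: "known t h"
  shows "indep_var borel h borel (\<lambda>\<omega>. f (inputs (Suc t) \<omega>))"
  unfolding indep_var_eq
proof (intro conjI)
  show hm: "h \<in> borel_measurable M" by (rule known_borel[OF h])
  show fm: "(\<lambda>\<omega>. f (inputs (Suc t) \<omega>)) \<in> borel_measurable M"
    by (rule measurable_compose[OF measurable_inputs]) simp
  let ?F = "vimage_algebra (space M) (inputs (Suc t)) (count_space UNIV)"
  let ?H = "vimage_algebra (space M) (hist t) (count_space UNIV)"
  have ind: "indep_set (sets ?F) (sets ?H)"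
    using inputs_indep_hist[of t] by (simp add: indep_rv_def)
  have F: "{(\<lambda>\<omega>. f (inputs (Suc t) \<omega>)) -` A \<inter> space M | A. A \<in> sets borel} \<subseteq> sets ?F"
  proof -
    have "(\<lambda>\<omega>. f (inputs (Suc t) \<omega>)) \<in> measurable ?F borel"
      by (rule measurable_compose[OF measurable_vimage_algebra1]) auto
    from measurable_sets[OF this] show ?thesis by auto
  qed
  have H: "{h -` A \<inter> space M | A. A \<in> sets borel} \<subseteq> sets ?H"
  proof -
    have "h \<in> measurable ?H borel"
      using measurable_compose[OF known_measurable(1)[OF h], of "\<lambda>x. x" borel] by simp
    from measurable_sets[OF this] show ?thesis by auto
  qed
  show "indep_set (sigma_sets (space M) {h -` A \<inter> space M |A. A \<in> sets borel})
     (sigma_sets (space M) {(\<lambda>\<omega>. f (inputs (Suc t) \<omega>)) -` A \<inter> space M |A. A \<in> sets borel})"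
  proof (rule indep_setI)
    have F': "sigma_sets (space M) {(\<lambda>\<omega>. f (inputs (Suc t) \<omega>)) -` A \<inter> space M |A. A \<in> sets borel} \<subseteq> sets ?F"
      using sets.sigma_sets_subset[OF F] by simp
    have H': "sigma_sets (space M) {h -` A \<inter> space M |A. A \<in> sets borel} \<subseteq> sets ?H"
      using sets.sigma_sets_subset[OF H] by simp
    show "sigma_sets (space M) {h -` A \<inter> space M |A. A \<in> sets borel} \<subseteq> events"
      using H' indep_setD_ev2[OF ind] by blast
    show "sigma_sets (space M) {(\<lambda>\<omega>. f (inputs (Suc t) \<omega>)) -` A \<inter> space M |A. A \<in> sets borel} \<subseteq> events"
      using F' indep_setD_ev1[OF ind] by blast
    show "prob (u \<inter> v) = prob u * prob v"
      if "u \<in> sigma_sets (space M) {h -` A \<inter> space M |A. A \<in> sets borel}"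
        "v \<in> sigma_sets (space M) {(\<lambda>\<omega>. f (inputs (Suc t) \<omega>)) -` A \<inter> space M |A. A \<in> sets borel}" for u v
      using indep_setD[OF ind subsetD[OF F' that(2)] subsetD[OF H' that(1)]]
      by (simp add: Int_commute mult.commute)
  qed
qed

text \<open>
  The conditional law of \<open>\<xi>\<close> is given only for elementary conditioning events, and there are countably
  many of these: the path up to time \<open>t\<close> is coded by a list.
\<close>

lemma AE_xi_idle: "AE \<omega> in M. \<forall>t. idle (fst (X t \<omega>)) \<noteq> {} \<longrightarrow> \<xi> (Suc t) \<omega> \<in> idle (fst (X t \<omega>))"
proof -
  have "AE \<omega> in M. \<not> (\<xi> (Suc t) \<omega> = l \<and> (\<forall>u<Suc t. X u \<omega> = xs ! u) \<and> inputs (Suc t) \<omega> = (b, c))"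
    if l: "l \<notin> idle (fst (xs ! t))" "idle (fst (xs ! t)) \<noteq> {}" for t l xs b c
  proof -
    let ?Q = "\<lambda>\<omega>. (\<forall>u<Suc t. X u \<omega> = xs ! u) \<and> a (Suc t) \<omega> = b \<and> (\<forall>i. s i (Suc t) \<omega> = c i)"
    have eq: "(inputs (Suc t) \<omega> = (b, c)) = (a (Suc t) \<omega> = b \<and> (\<forall>i. s i (Suc t) \<omega> = c i))" for \<omega>
      by (auto simp: inputs_def fun_eq_iff)
    have [measurable]: "Measurable.pred M (\<lambda>\<omega>. a (Suc t) \<omega> = b \<and> (\<forall>i. s i (Suc t) \<omega> = c i))"
      unfolding eq[symmetric] by measurable
    have Q: "Measurable.pred M ?Q" by measurable
    have "prob {\<omega>\<in>space M. \<xi> (Suc t) \<omega> = l \<and> ?Q \<omega>} = 0"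
    proof (cases "prob {\<omega>\<in>space M. ?Q \<omega>} > 0")
      case True
      from xi_conditional_law[of "Suc t" "\<lambda>u. xs ! u" b c l] True l
      have "cond_prob M (\<lambda>\<omega>. \<xi> (Suc t) \<omega> = l) ?Q = 0"
        by (simp add: xi_law_def pmf_of_set)
      then show ?thesis using True by (simp add: cond_prob_def)
    next
      case False
      then have "prob {\<omega>\<in>space M. ?Q \<omega>} = 0" using measure_nonneg[of M "{\<omega>\<in>space M. ?Q \<omega>}"] by linarith
      moreover have "prob {\<omega>\<in>space M. \<xi> (Suc t) \<omega> = l \<and> ?Q \<omega>} \<le> prob {\<omega>\<in>space M. ?Q \<omega>}"
        by (rule finite_measure_mono) (use Q in auto)
      ultimately show ?thesis by (simp add: measure_le_0_iff)
    qed
    then show ?thesis unfolding eq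
      by (subst (asm) prob_eq_0) (auto elim!: AE_mp intro!: AE_I2)
  qed
  then have "AE \<omega> in M. \<forall>t l xs b c. l \<notin> idle (fst (xs ! t)) \<longrightarrow> idle (fst (xs ! t)) \<noteq> {} \<longrightarrow>
      \<not> (\<xi> (Suc t) \<omega> = l \<and> (\<forall>u<Suc t. X u \<omega> = xs ! u) \<and> inputs (Suc t) \<omega> = (b, c))"
    unfolding AE_all_countable by auto
  then show ?thesis
  proof eventually_elim
    case (elim \<omega>)
    show ?case
    proof (intro allI impI; rule ccontr)
      fix t assume *: "idle (fst (X t \<omega>)) \<noteq> {}" "\<xi> (Suc t) \<omega> \<notin> idle (fst (X t \<omega>))"
      let ?xs = "map (\<lambda>u. X u \<omega>) [0..<Suc t]"
      have "?xs ! u = X u \<omega>" if "u < Suc t" for u using that by (simp del: upt_Suc)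
      then show False
        using elim[rule_format, of "\<xi> (Suc t) \<omega>" ?xs t "fst (inputs (Suc t) \<omega>)" "snd (inputs (Suc t) \<omega>)"] *
        by (simp del: upt_Suc)
    qed
  qed
qed

end

section \<open>Drift over one excursion\<close>

text \<open>
  The constants are chosen in the order \<open>\<delta>, \<epsilon>, c, \<gamma>, N, R\<close>: \<open>2 \<delta>\<close> is the surplus of service capacity, cut
  off at 1; \<open>\<epsilon>\<close> is a fraction of it, \<open>c\<close> smooths the queue that receives the arrivals, \<open>\<gamma>\<close> makes the quadratic term
  negligible, queues of length at least \<open>N\<close> count as long, and \<open>R\<close> is the size of a queue that
  compensates for any excursion of at most \<open>N\<close> slots.
\<close>

definition drift_parameters ::
  "nat pmf \<Rightarrow> ('n::finite \<Rightarrow> nat pmf) \<Rightarrow> nat \<Rightarrow> real \<Rightarrow> real \<Rightarrow> nat \<Rightarrow> bool" where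
  "drift_parameters pa ps smax \<gamma> \<epsilon> R \<longleftrightarrow> 0 < \<gamma> \<and> \<gamma> \<le> 1 \<and> 0 < \<epsilon> \<and> 0 < R \<and> (\<exists>\<delta> c N.
     \<epsilon> \<le> \<delta> / 4 \<and> 0 < c \<and>
     (measure_pmf.expectation pa (\<lambda>x. (real x)\<^sup>2) + (real smax)\<^sup>2) / (2 * c) \<le> \<delta> \<and>
     2 * \<delta> \<le> 1 \<and>
     2 * \<delta> \<le> (\<Sum>i\<in>UNIV. measure_pmf.expectation (ps i) real) - measure_pmf.expectation pa real \<and>
     \<gamma> * measure_pmf.expectation pa (\<lambda>x. (real x)\<^sup>2) * real smax \<le> \<delta> / 4 \<and>
     1 \<le> N \<and> 2 * real smax * (c + real CARD('n) * real smax) \<le> \<delta> * real N \<and>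
     smax * N \<le> R \<and>
     \<epsilon> + (real N)\<^sup>2 * measure_pmf.expectation pa (\<lambda>x. (real x)\<^sup>2) \<le> real R powr \<gamma>)"

lemma drift_parameters_exist:
  fixes ps :: "'n::finite \<Rightarrow> nat pmf"
  assumes "measure_pmf.expectation pa real < (\<Sum>i\<in>UNIV. measure_pmf.expectation (ps i) real)"
  obtains \<gamma> \<epsilon> R where "drift_parameters pa ps smax \<gamma> \<epsilon> R"
proof -
  define A2 where "A2 = measure_pmf.expectation pa (\<lambda>x. (real x)\<^sup>2)"
  have A2: "0 \<le> A2" by (simp add: A2_def)
  define \<Delta> where "\<Delta> = (\<Sum>i\<in>UNIV. measure_pmf.expectation (ps i) real) - measure_pmf.expectation pa real"
  define \<delta> where "\<delta> = min \<Delta> 1 / 2"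
  have \<delta>: "0 < \<delta>" "2 * \<delta> \<le> 1" "2 * \<delta> \<le> \<Delta>" using assms by (auto simp: \<delta>_def \<Delta>_def)
  \<comment> \<open>the summand 1 only keeps \<open>c\<close> positive\<close>
  define c where "c = (A2 + (real smax)\<^sup>2 + 1) / (2 * \<delta>)"
  have K: "0 < A2 + (real smax)\<^sup>2 + 1" using A2 by (simp add: add_nonneg_pos)
  have c: "0 < c" unfolding c_def using K \<delta> by simp
  have c': "(A2 + (real smax)\<^sup>2) / (2 * c) \<le> \<delta>"
    using c \<delta>(1) by (simp add: pos_divide_le_eq) (simp add: c_def)
  define \<gamma> where "\<gamma> = min 1 (\<delta> / (4 * (A2 * real smax + 1)))"
  have d: "0 < 4 * (A2 * real smax + 1)" using A2 by (simp add: add_nonneg_pos)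
  have \<gamma>: "0 < \<gamma>" "\<gamma> \<le> 1" using \<delta> d by (auto simp: \<gamma>_def)
  have "\<gamma> * (A2 * real smax) \<le> \<gamma> * (A2 * real smax + 1)" using \<gamma> by simp
  also have "\<dots> \<le> \<delta> / (4 * (A2 * real smax + 1)) * (A2 * real smax + 1)"
    using A2 by (intro mult_right_mono) (auto simp: \<gamma>_def)
  also have "\<dots> = \<delta> / 4" using d by (simp add: field_simps)
  finally have \<gamma>A: "\<gamma> * A2 * real smax \<le> \<delta> / 4" by simp
  obtain N0 :: nat where N0: "2 * real smax * (c + real CARD('n) * real smax) / \<delta> \<le> real N0"
    using real_arch_simple by blast
  define N where "N = max 1 N0"
  have N: "2 * real smax * (c + real CARD('n) * real smax) \<le> \<delta> * real N"
  proof -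
    have "2 * real smax * (c + real CARD('n) * real smax) \<le> real N0 * \<delta>"
      using N0 \<delta> by (simp add: pos_divide_le_eq)
    also have "\<dots> \<le> real N * \<delta>" using \<delta> by (intro mult_right_mono) (auto simp: N_def)
    finally show ?thesis by (simp add: mult.commute)
  qed
  let ?K = "\<delta> / 4 + (real N)\<^sup>2 * A2"
  obtain R0 :: nat where R0: "?K powr (1 / \<gamma>) \<le> real R0"
    using real_arch_simple by blast
  define R where "R = max (smax * N + 1) R0"
  have K0: "0 < ?K" using \<delta> A2 by (simp add: add_pos_nonneg)
  have "?K = (?K powr (1 / \<gamma>)) powr \<gamma>" using K0 \<gamma> by (simp add: powr_powr)
  also have "\<dots> \<le> real R powr \<gamma>" using R0 \<gamma> by (intro powr_mono2) (auto simp: R_def)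
  finally have R: "?K \<le> real R powr \<gamma>" .
  have "drift_parameters pa ps smax \<gamma> (\<delta> / 4) R"
    unfolding drift_parameters_def A2_def[symmetric] \<Delta>_def[symmetric]
    using \<gamma> \<delta> c c' \<gamma>A N R by (intro conjI exI[of _ \<delta>] exI[of _ c] exI[of _ N]) (auto simp: R_def N_def)
  then show thesis by (rule that)
qed

locale bounded_persistent_idle = persistent_idle M i1 pa ps a s \<xi> X
  for M :: "'w measure" and i1 :: "'n::finite" and pa ps a s \<xi> X +
  fixes smax :: nat
  assumes pa_mean: "integrable (measure_pmf pa) real"
    and pa_square: "integrable (measure_pmf pa) (\<lambda>x. (real x)\<^sup>2)"
    and ps_range: "\<And>i. set_pmf (ps i) \<subseteq> {1..smax}"
begin

definition lam :: real where "lam = measure_pmf.expectation pa real"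
definition mu :: "'n \<Rightarrow> real" where "mu i = measure_pmf.expectation (ps i) real"
definition A2 :: real where "A2 = measure_pmf.expectation pa (\<lambda>x. (real x)\<^sup>2)"

lemma A2_nonneg: "0 \<le> A2"
  by (simp add: A2_def)

lemma a_eq: "a (Suc t) = (\<lambda>\<omega>. fst (inputs (Suc t) \<omega>))"
  and s_eq: "s i (Suc t) = (\<lambda>\<omega>. snd (inputs (Suc t) \<omega>) i)"
  by (auto simp: inputs_def)

lemma measurable_a [measurable]: "a (Suc t) \<in> measurable M (count_space UNIV)"
  and measurable_s [measurable]: "s i (Suc t) \<in> measurable M (count_space UNIV)"
  unfolding a_eq s_eq by (rule measurable_compose[OF measurable_inputs], simp)+

lemma AE_s_range: "AE \<omega> in M. \<forall>t i. 1 \<le> s i (Suc t) \<omega> \<and> s i (Suc t) \<omega> \<le> smax"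
proof -
  have "AE \<omega> in M. s i (Suc t) \<omega> \<in> {1..smax}" for i t
  proof (rule AE_distrD[OF measurable_s])
    show "AE x in distr M (count_space UNIV) (s i (Suc t)). x \<in> {1..smax}"
      using ps_range[of i] by (subst law_s) (auto simp: AE_measure_pmf_iff)
  qed
  then show ?thesis unfolding AE_all_countable by simp
qed

lemma AE_path:
  "AE \<omega> in M. persistent_idle_path (\<lambda>t. X t \<omega>) (\<lambda>t. \<xi> t \<omega>) (\<lambda>t. a t \<omega>) (\<lambda>t i. s i t \<omega>) smax"
  using AE_s_range AE_xi_idle AE_space
  by eventually_elim (auto simp: persistent_idle_path_def X_recursion)

lemma
  shows integrable_a: "integrable M (\<lambda>\<omega>. real (a (Suc t) \<omega>))"
    and expectation_a: "expectation (\<lambda>\<omega>. real (a (Suc t) \<omega>)) = lam"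
    and integrable_a_square: "integrable M (\<lambda>\<omega>. (real (a (Suc t) \<omega>))\<^sup>2)"
    and expectation_a_square: "expectation (\<lambda>\<omega>. (real (a (Suc t) \<omega>))\<^sup>2) = A2"
    and integrable_s: "integrable M (\<lambda>\<omega>. real (s i (Suc t) \<omega>))"
    and expectation_s: "expectation (\<lambda>\<omega>. real (s i (Suc t) \<omega>)) = mu i"
proof -
  have a: "distr M (count_space UNIV) (a (Suc t)) = measure_pmf pa" by (rule law_a) simp
  have s: "distr M (count_space UNIV) (s i (Suc t)) = measure_pmf (ps i)" by (rule law_s) simp
  show "integrable M (\<lambda>\<omega>. real (a (Suc t) \<omega>))"
    by (rule integrable_distr[OF measurable_a]) (simp add: a pa_mean)
  show "integrable M (\<lambda>\<omega>. (real (a (Suc t) \<omega>))\<^sup>2)"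
    by (rule integrable_distr[OF measurable_a, of _ "\<lambda>x. (real x)\<^sup>2"]) (simp add: a pa_square)
  show "integrable M (\<lambda>\<omega>. real (s i (Suc t) \<omega>))"
  proof (rule integrable_distr[OF measurable_s])
    show "integrable (distr M (count_space UNIV) (s i (Suc t))) real" unfolding s
      by (rule measure_pmf.integrable_const_bound[where B=smax])
        (use ps_range[of i] in \<open>auto simp: AE_measure_pmf_iff\<close>)
  qed
  show "expectation (\<lambda>\<omega>. real (a (Suc t) \<omega>)) = lam"
    unfolding lam_def a[symmetric] by (subst integral_distr) auto
  show "expectation (\<lambda>\<omega>. (real (a (Suc t) \<omega>))\<^sup>2) = A2"
    unfolding A2_def a[symmetric] by (subst integral_distr) auto
  show "expectation (\<lambda>\<omega>. real (s i (Suc t) \<omega>)) = mu i"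
    unfolding mu_def s[symmetric] by (subst integral_distr) auto
qed

text \<open>
  So a second server alone already provides capacity 1, which is what is needed when server \<open>j\<close> is
  stable by itself.
\<close>

lemma mu_ge_1: "1 \<le> mu i"
proof -
  have "AE \<omega> in M. 1 \<le> real (s i (Suc 0) \<omega>)"
    using AE_s_range by eventually_elim auto
  then have "expectation (\<lambda>\<omega>. 1) \<le> expectation (\<lambda>\<omega>. real (s i (Suc 0) \<omega>))"
    by (intro integral_mono_AE integrable_s) auto
  then show ?thesis by (simp add: expectation_s prob_space)
qed

lemma
  fixes f :: "nat \<times> ('n \<Rightarrow> nat) \<Rightarrow> real" and h :: "'w \<Rightarrow> real"
  assumes h: "known t h" "\<And>\<omega>. \<bar>h \<omega>\<bar> \<le> 1" and f: "integrable M (\<lambda>\<omega>. f (inputs (Suc t) \<omega>))"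
  shows integrable_known_times_input: "integrable M (\<lambda>\<omega>. h \<omega> * f (inputs (Suc t) \<omega>))"
    and expectation_known_times_input:
      "expectation (\<lambda>\<omega>. h \<omega> * f (inputs (Suc t) \<omega>)) = expectation h * expectation (\<lambda>\<omega>. f (inputs (Suc t) \<omega>))"
    and integrable_known: "integrable M h"
proof -
  show *: "integrable M h"
    by (rule integrable_const_bound[where B=1]) (use h known_borel in auto)
  show "integrable M (\<lambda>\<omega>. h \<omega> * f (inputs (Suc t) \<omega>))"
    by (rule indep_var_integrable[OF indep_var_inputs_known[OF h(1)] * f])
  show "expectation (\<lambda>\<omega>. h \<omega> * f (inputs (Suc t) \<omega>)) = expectation h * expectation (\<lambda>\<omega>. f (inputs (Suc t) \<omega>))"
    by (rule indep_var_lebesgue_integral[OF indep_var_inputs_known[OF h(1)] * f])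
qed

lemma known_event: "known t (\<lambda>\<omega>. \<omega> \<in> C) \<Longrightarrow> C \<subseteq> space M \<Longrightarrow> C \<in> events"
  using known_measurable(2)[of t "\<lambda>\<omega>. \<omega> \<in> C"]
  by (simp add: pred_def Collect_conj_eq Int_absorb1)

lemma known_indicator: "known t (\<lambda>\<omega>. \<omega> \<in> C) \<Longrightarrow> known t (indicator C :: _ \<Rightarrow> real)"
  using known_fun[of t "\<lambda>\<omega>. \<omega> \<in> C" "\<lambda>b. of_bool b :: real"]
  by (simp add: indicator_def[abs_def])

lemma
  assumes C: "known t (\<lambda>\<omega>. \<omega> \<in> C)" "C \<subseteq> space M"
  shows integrable_arrivals_square:
      "integrable M (\<lambda>\<omega>. indicator C \<omega> * (\<Sum>u<N. real (a (Suc (t + u)) \<omega>))\<^sup>2)" (is "integrable M ?f")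
    and expectation_arrivals_square:
      "expectation (\<lambda>\<omega>. indicator C \<omega> * (\<Sum>u<N. real (a (Suc (t + u)) \<omega>))\<^sup>2) \<le> (real N)\<^sup>2 * A2 * prob C"
proof -
  have C': "C \<in> events" by (rule known_event[OF C])
  note [measurable] = C'
  have k: "known (t + u) (indicator C :: _ \<Rightarrow> real)" for u
    using known_mono[OF known_indicator[OF C(1)]] by simp
  have bd: "\<bar>indicator C \<omega> :: real\<bar> \<le> 1" for \<omega> by (auto simp: indicator_def)
  have f: "integrable M (\<lambda>\<omega>. (\<lambda>(x, y). (real x)\<^sup>2) (inputs (Suc (t + u)) \<omega>))" for u
    using integrable_a_square[of "t + u"] by (simp add: inputs_def)
  have int: "integrable M (\<lambda>\<omega>. indicator C \<omega> * (real (a (Suc (t + u)) \<omega>))\<^sup>2)"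
    and ex: "expectation (\<lambda>\<omega>. indicator C \<omega> * (real (a (Suc (t + u)) \<omega>))\<^sup>2) = prob C * A2" for u
    using integrable_known_times_input[OF k bd f[of u]] expectation_known_times_input[OF k bd f[of u]]
      expectation_a_square[of "t + u"] by (simp_all add: inputs_def)
  let ?g = "\<lambda>\<omega>. real N * (\<Sum>u<N. indicator C \<omega> * (real (a (Suc (t + u)) \<omega>))\<^sup>2)"
  have le: "?f \<omega> \<le> ?g \<omega>" for \<omega>
  proof -
    have "(\<Sum>u<N. real (a (Suc (t + u)) \<omega>))\<^sup>2 \<le> (\<Sum>u<N. (real (a (Suc (t + u)) \<omega>))\<^sup>2) * real (card {..<N})"
      by (rule sum_squared_le_sum_of_squares)
    then show ?thesis by (auto simp: indicator_def mult.commute)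
  qed
  have g: "integrable M ?g" by (intro integrable_mult_right Bochner_Integration.integrable_sum int)
  show f: "integrable M ?f"
    by (rule Bochner_Integration.integrable_bound[OF g])
      (use le in \<open>auto simp: sum_nonneg intro!: AE_I2\<close>)
  have "expectation ?f \<le> expectation ?g" by (rule integral_mono[OF f g le])
  also have "expectation ?g = real N * (\<Sum>u<N. prob C * A2)"
    unfolding integral_mult_right_zero
    by (subst Bochner_Integration.integral_sum, rule int) (simp only: ex)
  also have "\<dots> = (real N)\<^sup>2 * A2 * prob C"
    by (simp add: power2_eq_square)
  finally show "expectation ?f \<le> (real N)\<^sup>2 * A2 * prob C" .
qed

lemma measurable_X_at:
  assumes [measurable]: "\<theta> \<in> measurable M (count_space UNIV)"
  shows "(\<lambda>\<omega>. X (\<theta> \<omega>) \<omega>) \<in> measurable M (count_space UNIV)"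
  by (rule measurable_compose_countable[where f="\<lambda>i \<omega>. X i \<omega>" and g=\<theta>]) auto

lemma measurable_next_samp [measurable]:
  "(\<lambda>\<omega>. next_samp (\<lambda>t. X t \<omega>) t) \<in> measurable M (count_space UNIV)"
  unfolding next_samp_def by measurable

lemma measurable_next_samp_at:
  assumes [measurable]: "\<theta> \<in> measurable M (count_space UNIV)"
  shows "(\<lambda>\<omega>. next_samp (\<lambda>t. X t \<omega>) (\<theta> \<omega>)) \<in> measurable M (count_space UNIV)"
  by (rule measurable_compose_countable[where f="\<lambda>i \<omega>. next_samp (\<lambda>t. X t \<omega>) i" and g=\<theta>]) auto

lemma excursion_path:
  assumes "persistent_idle_path (\<lambda>t. X t \<omega>) (\<lambda>t. \<xi> t \<omega>) (\<lambda>t. a t \<omega>) (\<lambda>t i. s i t \<omega>) smax"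
    and "nonLI_idle \<alpha>" "X t \<omega> = \<alpha>" "\<xi> (Suc t) \<omega> = j"
  shows "excursion_path (\<lambda>t. X t \<omega>) (\<lambda>t. \<xi> t \<omega>) (\<lambda>t. a t \<omega>) (\<lambda>t i. s i t \<omega>) smax t (fst \<alpha>) j"
  using assms by (simp add: excursion_path_def excursion_path_axioms_def)

text \<open>
  During an excursion of at most \<open>N\<close> slots only queue \<open>j\<close> can grow, to at most the number of arrivals,
  whose second moment is at most \<open>N\<^sup>2 A2\<close>; and \<open>N\<^sup>2\<close> is bounded by the energy at the start.
\<close>

lemma energy_growth:
  assumes C: "known t (\<lambda>\<omega>. \<omega> \<in> C)" "C \<subseteq> space M"
    and X: "\<And>\<omega>. \<omega> \<in> C \<Longrightarrow> X t \<omega> = \<alpha>" and xi: "\<And>\<omega>. \<omega> \<in> C \<Longrightarrow> \<xi> (Suc t) \<omega> = j"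
    and \<alpha>: "nonLI_idle \<alpha>"
  shows "(\<integral>\<^sup>+\<omega>. ennreal (energy (X (next_samp (\<lambda>t. X t \<omega>) t) \<omega>)) * indicator C \<omega> \<partial>M)
    \<le> ennreal (1 + A2) * (\<integral>\<^sup>+\<omega>. ennreal (energy (X t \<omega>)) * indicator C \<omega> \<partial>M)"
proof -
  obtain i where i: "i \<noteq> j" using \<alpha> unfolding nonLI_idle_def by metis
  define N where "N = max 1 (fst \<alpha> i)"
  let ?f = "\<lambda>\<omega>. indicator C \<omega> * (\<Sum>u<N. real (a (Suc (t + u)) \<omega>))\<^sup>2"
  have C': "C \<in> events" by (rule known_event[OF C])
  note [measurable] = C'
  have "AE \<omega> in M. ennreal (energy (X (next_samp (\<lambda>t. X t \<omega>) t) \<omega>)) * indicator C \<omega>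
      \<le> ennreal (energy \<alpha> * indicator C \<omega> + ?f \<omega>)"
    using AE_path
  proof eventually_elim
    case (elim \<omega>)
    show ?case
    proof (cases "\<omega> \<in> C")
      case True
      interpret excursion_path "\<lambda>t. X t \<omega>" "\<lambda>t. \<xi> t \<omega>" "\<lambda>t. a t \<omega>" "\<lambda>t i. s i t \<omega>" smax t "fst \<alpha>" j
        by (rule excursion_path[OF elim \<alpha> X[OF True] xi[OF True]])
      show ?thesis
        using energy_step[OF T_le[OF i, folded N_def]] True X[OF True] next_samp_eq
        by (simp add: ennreal_leI)
    qed simp
  qed
  then have "(\<integral>\<^sup>+\<omega>. ennreal (energy (X (next_samp (\<lambda>t. X t \<omega>) t) \<omega>)) * indicator C \<omega> \<partial>M)
      \<le> (\<integral>\<^sup>+\<omega>. ennreal (energy \<alpha> * indicator C \<omega> + ?f \<omega>) \<partial>M)"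
    by (rule nn_integral_mono_AE)
  also have "\<dots> = ennreal (expectation (\<lambda>\<omega>. energy \<alpha> * indicator C \<omega> + ?f \<omega>))"
    using energy_ge_1[of \<alpha>] C' integrable_arrivals_square[OF C, of N]
    by (intro nn_integral_eq_integral) (auto simp: emeasure_eq_measure intro!: AE_I2 add_nonneg_nonneg)
  also have "expectation (\<lambda>\<omega>. energy \<alpha> * indicator C \<omega> + ?f \<omega>) = energy \<alpha> * prob C + expectation ?f"
    using C' integrable_arrivals_square[OF C, of N] by (subst Bochner_Integration.integral_add) (auto simp: emeasure_eq_measure)
  also have "\<dots> \<le> energy \<alpha> * prob C + (real N)\<^sup>2 * A2 * prob C"
    using expectation_arrivals_square[OF C, of N] by simp
  also have "\<dots> \<le> energy \<alpha> * prob C + energy \<alpha> * A2 * prob C"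
    using max_1_square_le_energy[of \<alpha> i] A2_nonneg
    by (intro add_left_mono mult_right_mono) (auto simp: N_def)
  also have "\<dots> = (1 + A2) * (energy \<alpha> * prob C)" by (simp add: algebra_simps)
  also have "ennreal \<dots> = ennreal (1 + A2) * (ennreal (energy \<alpha>) * emeasure M C)"
    using A2_nonneg energy_ge_1[of \<alpha>] by (simp add: emeasure_eq_measure ennreal_mult)
  also have "ennreal (energy \<alpha>) * emeasure M C = (\<integral>\<^sup>+\<omega>. ennreal (energy \<alpha>) * indicator C \<omega> \<partial>M)"
    using C' by (simp add: nn_integral_cmult)
  also have "\<dots> = (\<integral>\<^sup>+\<omega>. ennreal (energy (X t \<omega>)) * indicator C \<omega> \<partial>M)"
    by (intro nn_integral_cong) (auto simp: indicator_def X)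
  finally show ?thesis by (simp add: ennreal_leI)
qed

text \<open>
  Given the history, the first-order growth of the smoothed queue \<open>j\<close> is \<open>g (lam - mu j)\<close> in mean, with
  \<open>g \<in> [0, 1]\<close>.  If this is positive, replacing
  \<open>g\<close> by 1 leaves the difference between the total arrival and service rates; otherwise replacing \<open>g\<close> by 0
  leaves the work of the other servers, which is at least 1.  Both surpluses cover \<open>2 \<delta>\<close>.
\<close>

lemma smooth_increment_nonpos:
  assumes C: "known t (\<lambda>\<omega>. \<omega> \<in> C)" "C \<subseteq> space M"
    and c: "0 < c" "(A2 + (real smax)\<^sup>2) / (2 * c) \<le> \<delta>"
    and \<delta>: "2 * \<delta> \<le> 1" "2 * \<delta> \<le> (\<Sum>i\<in>UNIV. mu i) - lam"
    and ij: "(i :: 'n) \<noteq> j"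
  defines "f \<equiv> \<lambda>u \<omega>. indicator C \<omega> * (of_bool (quiet (\<lambda>t. X t \<omega>) t u) *
        (real (fst (X (t + u) \<omega>) j) / sqrt ((real (fst (X (t + u) \<omega>) j))\<^sup>2 + c\<^sup>2)
            * (real (a (Suc (t + u)) \<omega>) - real (s j (Suc (t + u)) \<omega>))
          + ((real (a (Suc (t + u)) \<omega>))\<^sup>2 + (real smax)\<^sup>2) / (2 * c)
          - (\<Sum>i\<in>-{j}. real (s i (Suc (t + u)) \<omega>)) + \<delta>))"
  shows "integrable M (f u)" "expectation (f u) \<le> 0"
proof -
  define h where "h \<omega> = (indicator C \<omega> * of_bool (quiet (\<lambda>t. X t \<omega>) t u) :: real)" for \<omega>
  define g where "g \<omega> = real (fst (X (t + u) \<omega>) j) / sqrt ((real (fst (X (t + u) \<omega>) j))\<^sup>2 + c\<^sup>2)" for \<omega>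
  define h' where "h' \<omega> = h \<omega> * g \<omega>" for \<omega>
  have g: "0 \<le> g \<omega>" "g \<omega> \<le> 1" for \<omega>
  proof -
    have "0 < sqrt ((real (fst (X (t + u) \<omega>) j))\<^sup>2 + c\<^sup>2)" using c by (simp add: add_nonneg_pos)
    moreover have "real (fst (X (t + u) \<omega>) j) \<le> sqrt ((real (fst (X (t + u) \<omega>) j))\<^sup>2 + c\<^sup>2)"
      by (intro real_le_rsqrt) simp
    ultimately show "0 \<le> g \<omega>" "g \<omega> \<le> 1" by (simp_all add: g_def)
  qed
  have h: "0 \<le> h \<omega>" "h \<omega> \<le> 1" for \<omega> by (auto simp: h_def indicator_def)
  have h': "0 \<le> h' \<omega>" "h' \<omega> \<le> h \<omega>" for \<omega>
    using g[of \<omega>] h[of \<omega>] by (auto simp: h'_def mult_left_le)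
  have kq: "known (t + u) (\<lambda>\<omega>. quiet (\<lambda>t. X t \<omega>) t u)"
    unfolding known_def
  proof (intro ballI impI)
    fix \<omega> \<omega>' assume w: "\<omega> \<in> space M" "\<omega>' \<in> space M" "hist (t + u) \<omega> = hist (t + u) \<omega>'"
    have "X (t + v) \<omega> = X (t + v) \<omega>'" if "v \<in> {1..u}" for v
      using that by (intro knownD[OF known_X[of "t + v" "t + u"] w(3) w(1) w(2)]) simp
    then show "quiet (\<lambda>t. X t \<omega>) t u = quiet (\<lambda>t. X t \<omega>') t u"
      by (simp add: quiet_def)
  qed
  have kh: "known (t + u) h"
    unfolding h_def
    by (rule known_fun2[OF known_mono[OF known_indicator[OF C(1)]] known_fun[OF kq]]) simp
  have kh': "known (t + u) h'"
    unfolding h'_def g_def by (rule known_fun2[OF kh known_fun[OF known_X[OF order_refl]]])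
  define f1 where "f1 = (\<lambda>(x :: nat, y :: 'n \<Rightarrow> nat). real x - real (y j))"
  define f2 where "f2 = (\<lambda>(x :: nat, y :: 'n \<Rightarrow> nat). ((real x)\<^sup>2 + (real smax)\<^sup>2) / (2 * c)
      - (\<Sum>i\<in>-{j}. real (y i)) + \<delta>)"
  have f1: "integrable M (\<lambda>\<omega>. f1 (inputs (Suc (t + u)) \<omega>))"
    "expectation (\<lambda>\<omega>. f1 (inputs (Suc (t + u)) \<omega>)) = lam - mu j"
    unfolding f1_def inputs_def prod.case using integrable_a integrable_s
    by (auto simp: expectation_a expectation_s)
  have f2: "integrable M (\<lambda>\<omega>. f2 (inputs (Suc (t + u)) \<omega>))"
    "expectation (\<lambda>\<omega>. f2 (inputs (Suc (t + u)) \<omega>))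
      = (A2 + (real smax)\<^sup>2) / (2 * c) - (\<Sum>i\<in>-{j}. mu i) + \<delta>"
    unfolding f2_def inputs_def prod.case using integrable_a_square integrable_s
    by (auto simp: expectation_a_square expectation_s prob_space)
  have f: "f u = (\<lambda>\<omega>. h' \<omega> * f1 (inputs (Suc (t + u)) \<omega>) + h \<omega> * f2 (inputs (Suc (t + u)) \<omega>))"
    by (auto simp: f_def h'_def h_def g_def f1_def f2_def inputs_def fun_eq_iff indicator_def algebra_simps)
  have b: "\<bar>h \<omega>\<bar> \<le> 1" "\<bar>h' \<omega>\<bar> \<le> 1" for \<omega>
    using h[of \<omega>] h'[of \<omega>] by auto
  note 1 = integrable_known_times_input[OF kh' b(2) f1(1)]
  note 2 = integrable_known_times_input[OF kh b(1) f2(1)]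
  show "integrable M (f u)" unfolding f using 1 2 by simp
  have E: "expectation (f u) = expectation h' * (lam - mu j)
      + expectation h * ((A2 + (real smax)\<^sup>2) / (2 * c) - (\<Sum>i\<in>-{j}. mu i) + \<delta>)"
    unfolding f using 1 2
    by (simp add: expectation_known_times_input[OF kh' b(2) f1(1)]
        expectation_known_times_input[OF kh b(1) f2(1)] f1(2) f2(2))
  have Eh: "0 \<le> expectation h'" "expectation h' \<le> expectation h"
    using h' by (auto intro!: integral_nonneg_AE AE_I2 integral_mono
        integrable_known[OF kh' b(2) f1(1)] integrable_known[OF kh b(1) f2(1)])
  have S: "(\<Sum>i\<in>UNIV. mu i) = mu j + (\<Sum>i\<in>-{j}. mu i)"
    by (subst sum.remove[of _ j]) (auto simp: Compl_eq_Diff_UNIV)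
  have "mu i \<le> (\<Sum>i\<in>-{j}. mu i)"
    using ij mu_ge_1 order_trans[OF zero_le_one mu_ge_1] by (intro member_le_sum) auto
  then have S1: "1 \<le> (\<Sum>i\<in>-{j}. mu i)" using mu_ge_1[of i] by linarith
  let ?d = "(A2 + (real smax)\<^sup>2) / (2 * c) - (\<Sum>i\<in>-{j}. mu i) + \<delta>"
  show "expectation (f u) \<le> 0"
  proof (cases "lam \<le> mu j")
    case True
    then have "expectation h' * (lam - mu j) \<le> 0" using Eh by (intro mult_nonneg_nonpos) auto
    moreover have "expectation h * ?d \<le> 0"
      using Eh c \<delta> S1 by (intro mult_nonneg_nonpos) auto
    ultimately show ?thesis using E by simp
  next
    case False
    then have "expectation h' * (lam - mu j) \<le> expectation h * (lam - mu j)"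
      using Eh by (intro mult_right_mono) auto
    moreover have "expectation h * (lam - mu j + ?d) \<le> 0"
      using Eh c \<delta> S by (intro mult_nonneg_nonpos) auto
    ultimately show ?thesis using E by (simp add: algebra_simps)
  qed
qed

lemma negative_drift:
  assumes C: "known t (\<lambda>\<omega>. \<omega> \<in> C)" "C \<subseteq> space M"
    and X: "\<And>\<omega>. \<omega> \<in> C \<Longrightarrow> X t \<omega> = \<alpha>" and xi: "\<And>\<omega>. \<omega> \<in> C \<Longrightarrow> \<xi> (Suc t) \<omega> = j"
    and \<alpha>: "nonLI_idle \<alpha>" and k: "R \<le> fst \<alpha> k"
    and par: "drift_parameters pa ps smax \<gamma> \<epsilon> R"
  defines "D \<equiv> \<lambda>\<omega>. lyapunov \<gamma> (X (next_samp (\<lambda>t. X t \<omega>) t) \<omega>) - lyapunov \<gamma> (X t \<omega>)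
      + \<epsilon> * (real (next_samp (\<lambda>t. X t \<omega>) t) - real t)"
  assumes int: "integrable M (\<lambda>\<omega>. indicator C \<omega> * D \<omega>)"
  shows "expectation (\<lambda>\<omega>. indicator C \<omega> * D \<omega>) \<le> 0"
proof -
  obtain \<delta> c N where \<gamma>: "0 < \<gamma>" "\<gamma> \<le> 1" and \<epsilon>: "0 \<le> \<epsilon>" "\<epsilon> \<le> \<delta> / 4"
    and c: "0 < c" "(A2 + (real smax)\<^sup>2) / (2 * c) \<le> \<delta>"
    and \<delta>: "2 * \<delta> \<le> 1" "2 * \<delta> \<le> (\<Sum>i\<in>UNIV. mu i) - lam"
    and A2: "\<gamma> * A2 * real smax \<le> \<delta> / 4"
    and N: "1 \<le> N" "2 * real smax * (c + real CARD('n) * real smax) \<le> \<delta> * real N"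
    and R: "0 < R" "smax * N \<le> R" "\<epsilon> + (real N)\<^sup>2 * A2 \<le> real R powr \<gamma>"
    using par unfolding drift_parameters_def lam_def[symmetric] mu_def[symmetric] A2_def[symmetric]
    by (auto intro: less_imp_le)
  note [measurable] = known_event[OF C]
  obtain i0 where i0: "i0 \<noteq> j" using \<alpha> unfolding nonLI_idle_def by metis
  define m where "m = Min (fst \<alpha> ` (-{j}))"
  have m: "\<And>i. i \<noteq> j \<Longrightarrow> m \<le> fst \<alpha> i" by (simp add: m_def)
  have "m \<in> fst \<alpha> ` (-{j})" unfolding m_def by (rule Min_in) (use i0 in auto)
  then obtain i where i: "i \<noteq> j" "fst \<alpha> i = m" by auto
  have E: "expectation (\<lambda>\<omega>. indicator C \<omega> * (\<Sum>u<n. real (a (Suc (t + u)) \<omega>))\<^sup>2) \<le> (real n)\<^sup>2 * A2 * prob C" for n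
    by (rule expectation_arrivals_square[OF C])
  note I = integrable_arrivals_square[OF C]
  have path: "excursion_path (\<lambda>t. X t \<omega>) (\<lambda>t. \<xi> t \<omega>) (\<lambda>t. a t \<omega>) (\<lambda>t i. s i t \<omega>) smax t (fst \<alpha>) j"
    if "persistent_idle_path (\<lambda>t. X t \<omega>) (\<lambda>t. \<xi> t \<omega>) (\<lambda>t. a t \<omega>) (\<lambda>t i. s i t \<omega>) smax" "\<omega> \<in> C" for \<omega>
    using excursion_path[OF that(1) \<alpha> X[OF that(2)] xi[OF that(2)]] .
  \<comment> \<open>a short queue bounds the excursion; otherwise all queues but \<open>j\<close> are long\<close>
  show ?thesis
  proof (cases "N \<le> m")
    case False
    let ?B = "\<lambda>\<omega>. indicator C \<omega> * (\<Sum>u<N. real (a (Suc (t + u)) \<omega>))\<^sup>2 - (real N)\<^sup>2 * A2 * indicator C \<omega>"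
    have B: "integrable M ?B" using I[of N] by (simp add: emeasure_eq_measure)
    have "AE \<omega> in M. indicator C \<omega> * D \<omega> \<le> ?B \<omega>"
      using AE_path
    proof eventually_elim
      case (elim \<omega>)
      show ?case
      proof (cases "\<omega> \<in> C")
        case True
        interpret excursion_path "\<lambda>t. X t \<omega>" "\<lambda>t. \<xi> t \<omega>" "\<lambda>t. a t \<omega>" "\<lambda>t i. s i t \<omega>" smax t "fst \<alpha>" j
          by (rule path[OF elim True])
        show ?thesis
          using drift_some_queue_short[OF \<gamma> i(1) _ N(1) R(1,2) k R(3) A2_nonneg] False True i
          by (simp add: D_def next_samp_eq)
      qed simp
    qed
    then have "expectation (\<lambda>\<omega>. indicator C \<omega> * D \<omega>) \<le> expectation ?B"
      by (rule integral_mono_AE[OF int B])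
    also have "\<dots> \<le> 0" using I[of N] E[of N] by (simp add: emeasure_eq_measure)
    finally show ?thesis .
  next
    case True
    then have m1: "1 \<le> m" using N by simp
    let ?f = "\<lambda>u \<omega>. indicator C \<omega> * (of_bool (quiet (\<lambda>t. X t \<omega>) t u) *
        (real (fst (X (t + u) \<omega>) j) / sqrt ((real (fst (X (t + u) \<omega>) j))\<^sup>2 + c\<^sup>2)
            * (real (a (Suc (t + u)) \<omega>) - real (s j (Suc (t + u)) \<omega>))
          + ((real (a (Suc (t + u)) \<omega>))\<^sup>2 + (real smax)\<^sup>2) / (2 * c)
          - (\<Sum>i\<in>-{j}. real (s i (Suc (t + u)) \<omega>)) + \<delta>))"
    let ?g = "\<lambda>\<omega>. indicator C \<omega> * (\<Sum>u<m. real (a (Suc (t + u)) \<omega>))\<^sup>2 / real m - real m * A2 * indicator C \<omega>"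
    let ?B = "\<lambda>\<omega>. real m powr \<gamma> * ((\<Sum>u<m. ?f u \<omega>) + \<gamma> * ?g \<omega>)"
    note f = smooth_increment_nonpos[OF C c \<delta> i(1)]
    have g: "integrable M ?g" using I[of m] by (simp add: emeasure_eq_measure)
    have f': "integrable M (\<lambda>\<omega>. \<Sum>u<m. ?f u \<omega>)"
      by (rule Bochner_Integration.integrable_sum) (rule f(1))
    have B: "integrable M ?B"
      by (intro integrable_mult_right Bochner_Integration.integrable_add f' g)
    have large: "2 * real smax * (c + real CARD('n) * real smax) \<le> \<delta> * real m"
    proof -
      have "\<delta> * real N \<le> \<delta> * real m" using True \<epsilon> by (intro mult_left_mono) auto
      then show ?thesis using N(2) by linarith
    qed
    have "AE \<omega> in M. indicator C \<omega> * D \<omega> \<le> ?B \<omega>"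
      using AE_path
    proof eventually_elim
      case (elim \<omega>)
      show ?case
      proof (cases "\<omega> \<in> C")
        case True
        interpret excursion_path "\<lambda>t. X t \<omega>" "\<lambda>t. \<xi> t \<omega>" "\<lambda>t. a t \<omega>" "\<lambda>t i. s i t \<omega>" smax t "fst \<alpha>" j
          by (rule path[OF elim True])
        show ?thesis
          using drift_all_queues_long[OF \<gamma> c(1) \<epsilon> m1 m _ A2 A2_nonneg large] i True
          by (auto simp: D_def next_samp_eq)
      qed simp
    qed
    then have "expectation (\<lambda>\<omega>. indicator C \<omega> * D \<omega>) \<le> expectation ?B"
      by (rule integral_mono_AE[OF int B])
    also have "expectation ?B = real m powr \<gamma> * (expectation (\<lambda>\<omega>. \<Sum>u<m. ?f u \<omega>) + \<gamma> * expectation ?g)"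
      using f' g by (simp only: integral_mult_right_zero Bochner_Integration.integral_add integrable_mult_right)
    also have "\<dots> \<le> 0"
    proof (rule mult_nonneg_nonpos)
      have "expectation (\<lambda>\<omega>. \<Sum>u<m. ?f u \<omega>) = (\<Sum>u<m. expectation (?f u))"
        by (rule Bochner_Integration.integral_sum) (rule f(1))
      also have "\<dots> \<le> 0" by (rule sum_nonpos) (rule f(2))
      finally have 1: "expectation (\<lambda>\<omega>. \<Sum>u<m. ?f u \<omega>) \<le> 0" .
      have "expectation ?g = expectation (\<lambda>\<omega>. indicator C \<omega> * (\<Sum>u<m. real (a (Suc (t + u)) \<omega>))\<^sup>2) / real m - real m * A2 * prob C"
        using I[of m] by (simp add: emeasure_eq_measure)
      also have "\<dots> \<le> 0" using E[of m] m1 by (simp add: field_simps power2_eq_square)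
      finally have "\<gamma> * expectation ?g \<le> 0" using \<gamma> by (intro mult_nonneg_nonpos) auto
      then show "expectation (\<lambda>\<omega>. \<Sum>u<m. ?f u \<omega>) + \<gamma> * expectation ?g \<le> 0" using 1 by simp
    qed simp
    finally show ?thesis .
  qed
qed

end

section \<open>Sampling times\<close>

lemma Inf_enat_image:
  assumes "\<exists>t. P t"
  shows "Inf (enat ` {t. P t}) = enat (LEAST t. P t)"
  by (rule cInf_eq_minimum) (auto intro: LeastI_ex[OF assms] Least_le)

lemma Inf_enat_image_le: "Inf (enat ` {t. P t}) \<le> enat n \<longleftrightarrow> (\<exists>t\<le>n. P t)"
proof (cases "\<exists>t. P t")
  case True
  show ?thesis unfolding Inf_enat_image[OF True]
    using LeastI_ex[OF True] by (auto intro: order_trans[OF Least_le])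
next
  case False
  then have "enat ` {t. P t} = {}" by auto
  then show ?thesis using False by (simp add: top_enat_def)
qed

lemma samp_time_0_le: "samp_time X 0 \<omega> \<le> enat n \<longleftrightarrow> (\<exists>u\<in>{1..n}. nonLI_idle (X u \<omega>))"
  by (auto simp: Inf_enat_image_le)

lemma enat_less_iff_le_pred: "e < enat u \<longleftrightarrow> 1 \<le> u \<and> e \<le> enat (u - 1)"
  by (cases e) (auto simp: zero_enat_def)

lemma samp_time_Suc_le: "samp_time X (Suc k) \<omega> \<le> enat n
    \<longleftrightarrow> (\<exists>u\<in>{1..n}. samp_time X k \<omega> \<le> enat (u - 1) \<and> nonLI_idle (X u \<omega>))"
  unfolding samp_time.simps Inf_enat_image_le by (auto simp: enat_less_iff_le_pred)

lemma samp_time_mono: "i \<le> k \<Longrightarrow> samp_time X i \<omega> \<le> samp_time X k \<omega>"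
proof (induction k)
  case (Suc k)
  have "samp_time X k \<omega> \<le> samp_time X (Suc k) \<omega>"
    unfolding samp_time.simps by (rule Inf_greatest) auto
  then show ?case using Suc by (auto simp: le_Suc_eq simp del: samp_time.simps intro: order_trans)
qed simp

lemma less_hit_time_iff: "enat k < hit_time X A \<omega> \<longleftrightarrow> (\<forall>i\<le>k. samp_chain X i \<omega> \<notin> A)"
  unfolding hit_time_def not_le[symmetric] Inf_enat_image_le by auto

lemma samp_time_le_cong:
  assumes "\<And>u. u \<le> t \<Longrightarrow> X u \<omega> = X u \<omega>'" "n \<le> t"
  shows "samp_time X k \<omega> \<le> enat n \<longleftrightarrow> samp_time X k \<omega>' \<le> enat n"
  using assms(2)
proof (induction k arbitrary: n)
  case 0
  then show ?case unfolding samp_time_0_le using assms(1) by auto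
next
  case (Suc k)
  have "samp_time X k \<omega> \<le> enat (u - 1) \<longleftrightarrow> samp_time X k \<omega>' \<le> enat (u - 1)"
    "X u \<omega> = X u \<omega>'" if "u \<in> {1..n}" for u
    using that Suc.prems by (auto intro!: Suc.IH assms(1))
  then show ?case unfolding samp_time_Suc_le by auto
qed

lemma samp_time_cong:
  assumes X: "\<And>u. u \<le> t \<Longrightarrow> X u \<omega> = X u \<omega>'" and le: "samp_time X k \<omega> \<le> enat t"
  shows "samp_time X k \<omega>' = samp_time X k \<omega>"
proof -
  obtain n where n: "samp_time X k \<omega> = enat n" "n \<le> t"
    using le by (cases "samp_time X k \<omega>") auto
  have 1: "samp_time X k \<omega>' \<le> enat n"
    using samp_time_le_cong[of t X \<omega> \<omega>' n k] X n by auto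
  then obtain n' where n': "samp_time X k \<omega>' = enat n'" "n' \<le> n"
    by (cases "samp_time X k \<omega>'") auto
  have "samp_time X k \<omega> \<le> enat n'"
    using samp_time_le_cong[of t X \<omega> \<omega>' n' k] X n n' by auto
  then show ?thesis using n n' by simp
qed

context bounded_persistent_idle
begin

lemma measurable_xi_at:
  assumes [measurable]: "\<theta> \<in> measurable M (count_space UNIV)"
  shows "(\<lambda>\<omega>. \<xi> (Suc (\<theta> \<omega>)) \<omega>) \<in> measurable M (count_space UNIV)"
  by (rule measurable_compose_countable[where f="\<lambda>i \<omega>. \<xi> (Suc i) \<omega>" and g=\<theta>]) auto

lemma known_piece:
  assumes "known t (\<lambda>\<omega>. \<omega> \<in> E \<and> \<theta> \<omega> = t)"
  shows "known t (\<lambda>\<omega>. \<omega> \<in> {\<omega> \<in> E. (\<theta> \<omega>, X (\<theta> \<omega>) \<omega>, \<xi> (Suc (\<theta> \<omega>)) \<omega>) = (t, \<alpha>, j)})"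
proof -
  have "known t (\<lambda>\<omega>. (\<omega> \<in> E \<and> \<theta> \<omega> = t) \<and> (X t \<omega> = \<alpha> \<and> \<xi> (Suc t) \<omega> = j))"
    by (intro known_fun2[where h="(\<and>)"] assms known_fun2[where h="\<lambda>x y. x = \<alpha> \<and> y = j"] known_X known_xi) auto
  also have "(\<lambda>\<omega>. (\<omega> \<in> E \<and> \<theta> \<omega> = t) \<and> (X t \<omega> = \<alpha> \<and> \<xi> (Suc t) \<omega> = j))
      = (\<lambda>\<omega>. \<omega> \<in> {\<omega> \<in> E. (\<theta> \<omega>, X (\<theta> \<omega>) \<omega>, \<xi> (Suc (\<theta> \<omega>)) \<omega>) = (t, \<alpha>, j)})"
    by auto
  finally show ?thesis .
qed

text \<open>
  Sum of \<open>energy_growth\<close> over the countably many values of the time, the state and the tie-breaking server.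
  The set \<open>E\<close> serves to cut off the event on which the time is infinite.
\<close>

lemma energy_growth_random_time:
  assumes E: "E \<in> events" "\<And>t. known t (\<lambda>\<omega>. \<omega> \<in> E \<and> \<theta> \<omega> = t)"
    and \<theta>[measurable]: "\<theta> \<in> measurable M (count_space UNIV)"
    and idle: "AE \<omega> in M. \<omega> \<in> E \<longrightarrow> nonLI_idle (X (\<theta> \<omega>) \<omega>)"
  shows "(\<integral>\<^sup>+\<omega>. ennreal (energy (X (next_samp (\<lambda>t. X t \<omega>) (\<theta> \<omega>)) \<omega>)) * indicator E \<omega> \<partial>M)
    \<le> ennreal (1 + A2) * (\<integral>\<^sup>+\<omega>. ennreal (energy (X (\<theta> \<omega>) \<omega>)) * indicator E \<omega> \<partial>M)"
proof -
  note [measurable] = E(1) measurable_X_at[OF \<theta>] measurable_xi_at[OF \<theta>]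
    measurable_X_at[OF measurable_next_samp_at[OF \<theta>]]
  define \<kappa> where "\<kappa> \<omega> = (\<theta> \<omega>, X (\<theta> \<omega>) \<omega>, \<xi> (Suc (\<theta> \<omega>)) \<omega>)" for \<omega>
  have \<kappa>[measurable]: "\<kappa> \<in> measurable M (count_space UNIV)"
    unfolding \<kappa>_def[abs_def] by measurable
  have energy[measurable]: "energy \<in> borel_measurable (count_space UNIV)" by simp
  have piece: "(\<integral>\<^sup>+\<omega>. ennreal (energy (X (next_samp (\<lambda>t. X t \<omega>) (\<theta> \<omega>)) \<omega>)) * indicator E \<omega> * indicator {c} (\<kappa> \<omega>) \<partial>M)
      \<le> ennreal (1 + A2) * (\<integral>\<^sup>+\<omega>. ennreal (energy (X (\<theta> \<omega>) \<omega>)) * indicator E \<omega> * indicator {c} (\<kappa> \<omega>) \<partial>M)" for c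
  proof -
    obtain t \<alpha> j where c: "c = (t, \<alpha>, j)" by (cases c)
    let ?C = "{\<omega> \<in> E. (\<theta> \<omega>, X (\<theta> \<omega>) \<omega>, \<xi> (Suc (\<theta> \<omega>)) \<omega>) = (t, \<alpha>, j)}"
    have C: "known t (\<lambda>\<omega>. \<omega> \<in> ?C)" by (rule known_piece[OF E(2)])
    have CM: "?C \<subseteq> space M" using sets.sets_into_space[OF E(1)] by auto
    have eq: "(\<integral>\<^sup>+\<omega>. ennreal (energy (X (next_samp (\<lambda>t. X t \<omega>) (\<theta> \<omega>)) \<omega>)) * indicator E \<omega> * indicator {c} (\<kappa> \<omega>) \<partial>M)
        = (\<integral>\<^sup>+\<omega>. ennreal (energy (X (next_samp (\<lambda>t. X t \<omega>) t) \<omega>)) * indicator ?C \<omega> \<partial>M)"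
      "(\<integral>\<^sup>+\<omega>. ennreal (energy (X (\<theta> \<omega>) \<omega>)) * indicator E \<omega> * indicator {c} (\<kappa> \<omega>) \<partial>M)
        = (\<integral>\<^sup>+\<omega>. ennreal (energy (X t \<omega>)) * indicator ?C \<omega> \<partial>M)"
      by (rule nn_integral_cong; auto simp: indicator_def c \<kappa>_def)+
    show ?thesis
    proof (cases "nonLI_idle \<alpha>")
      case True
      show ?thesis unfolding eq by (rule energy_growth[where j=j, OF C CM _ _ True]) auto
    next
      case False
      have "(\<integral>\<^sup>+\<omega>. ennreal (energy (X (next_samp (\<lambda>t. X t \<omega>) t) \<omega>)) * indicator ?C \<omega> \<partial>M) = (\<integral>\<^sup>+\<omega>. 0 \<partial>M)"
        by (rule nn_integral_cong_AE)
          (use idle in eventually_elim, use False in \<open>auto simp: indicator_def\<close>)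
      then show ?thesis unfolding eq by simp
    qed
  qed
  show ?thesis
    apply (subst nn_integral_countable_partition[where \<kappa>=\<kappa>], measurable)
    apply (subst (2) nn_integral_countable_partition[where \<kappa>=\<kappa>], measurable)
    apply (subst nn_integral_cmult[symmetric])
    apply (simp, intro nn_integral_mono piece)
    done
qed

lemma AE_next_samp:
  "AE \<omega> in M. \<forall>t. nonLI_idle (X t \<omega>) \<longrightarrow>
     (\<exists>u>t. nonLI_idle (X u \<omega>)) \<and> t < next_samp (\<lambda>t. X t \<omega>) t \<and> nonLI_idle (X (next_samp (\<lambda>t. X t \<omega>) t) \<omega>)
     \<and> real (next_samp (\<lambda>t. X t \<omega>) t) - real t \<le> energy (X t \<omega>)"
  using AE_path
proof eventually_elim
  case (elim \<omega>)
  show ?case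
  proof (intro allI impI)
    fix t assume t: "nonLI_idle (X t \<omega>)"
    interpret excursion_path "\<lambda>t. X t \<omega>" "\<lambda>t. \<xi> t \<omega>" "\<lambda>t. a t \<omega>" "\<lambda>t i. s i t \<omega>" smax t "fst (X t \<omega>)" "\<xi> (Suc t) \<omega>"
      by (rule excursion_path[OF elim t]) auto
    obtain i where i: "i \<noteq> \<xi> (Suc t) \<omega>" using other_server by auto
    have 1: "1 \<le> real (max 1 (fst (X t \<omega>) i))" by simp
    have "real T \<le> real (max 1 (fst (X t \<omega>) i))" using T_le[OF i] by linarith
    also have "\<dots> \<le> (real (max 1 (fst (X t \<omega>) i)))\<^sup>2"
      using mult_left_mono[OF 1, of "real (max 1 (fst (X t \<omega>) i))"] by (simp add: power2_eq_square)
    also have "\<dots> \<le> energy (X t \<omega>)" by (rule max_1_square_le_energy)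
    finally show "(\<exists>u>t. nonLI_idle (X u \<omega>)) \<and> t < next_samp (\<lambda>t. X t \<omega>) t \<and> nonLI_idle (X (next_samp (\<lambda>t. X t \<omega>) t) \<omega>)
        \<and> real (next_samp (\<lambda>t. X t \<omega>) t) - real t \<le> energy (X t \<omega>)"
      using T_idle T_pos next_samp_eq by (auto intro!: exI[of _ "t + T"])
  qed
qed

lemma AE_samp_time:
  "AE \<omega> in M. nonLI_idle (X 0 \<omega>) \<longrightarrow>
     samp_time X 0 \<omega> = enat (next_samp (\<lambda>t. X t \<omega>) 0) \<and>
     (\<forall>k. \<exists>t. samp_time X k \<omega> = enat t \<and> nonLI_idle (X t \<omega>) \<and>
        samp_time X (Suc k) \<omega> = enat (next_samp (\<lambda>t. X t \<omega>) t))"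
  using AE_next_samp
proof eventually_elim
  case (elim \<omega>)
  show ?case
  proof
    assume 0: "nonLI_idle (X 0 \<omega>)"
    have e: "samp_time X 0 \<omega> = enat (next_samp (\<lambda>t. X t \<omega>) 0)"
      unfolding samp_time.simps next_samp_def
      using Inf_enat_image[of "\<lambda>t. t > 0 \<and> nonLI_idle (X t \<omega>)"] elim 0
      by (auto simp: Suc_le_eq)
    have suc: "samp_time X (Suc k) \<omega> = enat (next_samp (\<lambda>t. X t \<omega>) t)"
      if "samp_time X k \<omega> = enat t" "nonLI_idle (X t \<omega>)" for k t
      unfolding samp_time.simps(2) that(1) next_samp_def
      using Inf_enat_image[of "\<lambda>u. u > t \<and> nonLI_idle (X u \<omega>)"] elim that(2) by auto
    have "\<exists>t. samp_time X k \<omega> = enat t \<and> nonLI_idle (X t \<omega>)" for k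
    proof (induction k)
      case 0
      then show ?case using e elim \<open>nonLI_idle (X 0 \<omega>)\<close> by blast
    next
      case (Suc k)
      then show ?case using suc elim by blast
    qed
    then show "samp_time X 0 \<omega> = enat (next_samp (\<lambda>t. X t \<omega>) 0) \<and>
      (\<forall>k. \<exists>t. samp_time X k \<omega> = enat t \<and> nonLI_idle (X t \<omega>) \<and>
        samp_time X (Suc k) \<omega> = enat (next_samp (\<lambda>t. X t \<omega>) t))"
      using e suc by blast
  qed
qed

text \<open>
  The finite exceptional set has to consist of reachable states, so unreachable states with short queues
  must be excluded along the path.  If no server is idle, \<open>\<xi>\<close> does not enter the recursion
  and may be replaced by \<open>i1\<close>, the value that carries its conditional law.
\<close>

lemma AE_state_space: "AE \<omega> in M. \<forall>t. X t \<omega> \<in> state_space i1 pa ps"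
proof -
  have a: "AE \<omega> in M. \<forall>t. a (Suc t) \<omega> \<in> set_pmf pa"
    unfolding AE_all_countable
  proof
    fix t show "AE \<omega> in M. a (Suc t) \<omega> \<in> set_pmf pa"
      by (rule AE_distrD[OF measurable_a]) (subst law_a, auto simp: AE_measure_pmf_iff)
  qed
  have s: "AE \<omega> in M. \<forall>t i. s i (Suc t) \<omega> \<in> set_pmf (ps i)"
    unfolding AE_all_countable
  proof (intro allI)
    fix t i show "AE \<omega> in M. s i (Suc t) \<omega> \<in> set_pmf (ps i)"
      by (rule AE_distrD[OF measurable_s]) (subst law_s, auto simp: AE_measure_pmf_iff)
  qed
  show ?thesis
    using a s X0_state_space AE_xi_idle AE_space
  proof eventually_elim
    case (elim \<omega>)
    show ?case
    proof
      fix t show "X t \<omega> \<in> state_space i1 pa ps"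
      proof (induction t)
        case 0
        then show ?case using elim by simp
      next
        case (Suc t)
        then obtain i n where n: "X t \<omega> \<in> set_pmf (kernel_pow i1 pa ps n (\<lambda>_. 0, i))"
          by (auto simp: state_space_def set_pmf_iff dest: order.strict_implies_not_eq[symmetric] less_imp_neq)
        define x where "x = (if idle (fst (X t \<omega>)) = {} then i1 else \<xi> (Suc t) \<omega>)"
        have "X (Suc t) \<omega> = next_state (\<xi> (Suc t) \<omega>) (a (Suc t) \<omega>) (\<lambda>i. s i (Suc t) \<omega>) (X t \<omega>)"
          using X_recursion[of "Suc t" \<omega>] elim by simp
        also have "\<dots> = next_state x (a (Suc t) \<omega>) (\<lambda>i. s i (Suc t) \<omega>) (X t \<omega>)"
          by (simp add: next_state_def x_def split_beta)
        finally have X: "X (Suc t) \<omega> = next_state x (a (Suc t) \<omega>) (\<lambda>i. s i (Suc t) \<omega>) (X t \<omega>)" .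
        have x: "x \<in> set_pmf (xi_law i1 (fst (X t \<omega>)))"
          using elim(4) by (auto simp: xi_law_def x_def set_pmf_of_set)
        have s': "(\<lambda>i. s i (Suc t) \<omega>) \<in> set_pmf (Pi_pmf UNIV 0 ps)"
          using elim(2) by (subst set_Pi_pmf) (auto simp: PiE_dflt_def)
        have "X (Suc t) \<omega> \<in> set_pmf (kernel i1 pa ps (X t \<omega>))"
          unfolding kernel_def X set_bind_pmf
          using x s' elim(1) by auto
        then have "X (Suc t) \<omega> \<in> set_pmf (kernel_pow i1 pa ps (Suc n) (\<lambda>_. 0, i))"
          using n by auto
        then have "0 < pmf (kernel_pow i1 pa ps (Suc n) (\<lambda>_. 0, i)) (X (Suc t) \<omega>)"
          by (rule pmf_positive)
        then show ?case unfolding state_space_def by blast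
      qed
    qed
  qed
qed

end

lemma the_enat_measurable [measurable]: "the_enat \<in> measurable borel (count_space UNIV)"
proof -
  have "A \<in> sets borel" for A :: "enat set"
    by (rule sets.countable) (auto intro: countableI_type)
  then show ?thesis by (auto simp: measurable_def)
qed

context bounded_persistent_idle
begin

abbreviation F where "F \<equiv> xi_filtration M \<xi> X"
abbreviation \<tau> where "\<tau> k \<omega> \<equiv> the_enat (samp_time X k \<omega>)"

lemma negative_drift_random_time:
  assumes E: "E \<in> events" "\<And>t. known t (\<lambda>\<omega>. \<omega> \<in> E \<and> \<theta> \<omega> = t)"
    and \<theta>[measurable]: "\<theta> \<in> measurable M (count_space UNIV)"
    and large: "AE \<omega> in M. \<omega> \<in> E \<longrightarrow> nonLI_idle (X (\<theta> \<omega>) \<omega>) \<and> (\<exists>k. R \<le> fst (X (\<theta> \<omega>) \<omega>) k)"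
    and par: "drift_parameters pa ps smax \<gamma> \<epsilon> R"
  defines "D \<equiv> \<lambda>\<omega>. lyapunov \<gamma> (X (next_samp (\<lambda>t. X t \<omega>) (\<theta> \<omega>)) \<omega>) - lyapunov \<gamma> (X (\<theta> \<omega>) \<omega>)
      + \<epsilon> * (real (next_samp (\<lambda>t. X t \<omega>) (\<theta> \<omega>)) - real (\<theta> \<omega>))"
  assumes int: "integrable M (\<lambda>\<omega>. indicator E \<omega> * D \<omega>)"
  shows "expectation (\<lambda>\<omega>. indicator E \<omega> * D \<omega>) \<le> 0"
proof -
  note [measurable] = E(1) measurable_X_at[OF \<theta>] measurable_xi_at[OF \<theta>]
  define \<kappa> where "\<kappa> \<omega> = (\<theta> \<omega>, X (\<theta> \<omega>) \<omega>, \<xi> (Suc (\<theta> \<omega>)) \<omega>)" for \<omega>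
  have \<kappa>[measurable]: "\<kappa> \<in> measurable M (count_space UNIV)"
    unfolding \<kappa>_def[abs_def] by measurable
  show ?thesis
  proof (rule integral_nonpos_countable_partition[OF int \<kappa>])
    fix c :: "nat \<times> 'n state \<times> 'n"
    obtain t \<alpha> j where c: "c = (t, \<alpha>, j)" by (cases c)
    let ?C = "{\<omega> \<in> E. (\<theta> \<omega>, X (\<theta> \<omega>) \<omega>, \<xi> (Suc (\<theta> \<omega>)) \<omega>) = (t, \<alpha>, j)}"
    let ?D = "\<lambda>\<omega>. lyapunov \<gamma> (X (next_samp (\<lambda>t. X t \<omega>) t) \<omega>) - lyapunov \<gamma> (X t \<omega>)
      + \<epsilon> * (real (next_samp (\<lambda>t. X t \<omega>) t) - real t)"
    have C: "known t (\<lambda>\<omega>. \<omega> \<in> ?C)" by (rule known_piece[OF E(2)])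
    have CM: "?C \<subseteq> space M" using sets.sets_into_space[OF E(1)] by auto
    have eq: "indicator E \<omega> * D \<omega> * indicator {c} (\<kappa> \<omega>) = indicator ?C \<omega> * ?D \<omega>" for \<omega>
      by (auto simp: indicator_def c \<kappa>_def D_def)
    have "integrable M (\<lambda>\<omega>. indicator E \<omega> * D \<omega> * indicator {c} (\<kappa> \<omega>))"
      by (rule Bochner_Integration.integrable_bound[OF int])
        (use int in \<open>auto simp: indicator_def intro!: borel_measurable_times borel_measurable_integrable\<close>)
    then have intC: "integrable M (\<lambda>\<omega>. indicator ?C \<omega> * ?D \<omega>)" unfolding eq .
    show "expectation (\<lambda>\<omega>. indicator E \<omega> * D \<omega> * indicator {c} (\<kappa> \<omega>)) \<le> 0"
      unfolding eq
    proof (cases "nonLI_idle \<alpha> \<and> (\<exists>k. R \<le> fst \<alpha> k)")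
      case True
      then obtain k where k: "nonLI_idle \<alpha>" "R \<le> fst \<alpha> k" by blast
      show "expectation (\<lambda>\<omega>. indicator ?C \<omega> * ?D \<omega>) \<le> 0"
        by (rule negative_drift[where j=j, OF C CM _ _ k par intC]) auto
    next
      case False
      have "AE \<omega> in M. indicator ?C \<omega> * ?D \<omega> = 0"
        using large by eventually_elim (use False in \<open>auto simp: indicator_def\<close>)
      then show "expectation (\<lambda>\<omega>. indicator ?C \<omega> * ?D \<omega>) \<le> 0"
        by (simp add: integral_eq_zero_AE)
    qed
  qed
qed

lemma xi_filtration_gen:
  "{X u -` B \<inter> space M | u B. enat u \<le> t} \<union> {\<xi> u -` B \<inter> space M | u B. 1 \<le> u \<and> enat u \<le> t + 1} \<subseteq> events"
  by (auto intro!: measurable_sets[OF measurable_X] measurable_sets[OF xi_measurable])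

lemma space_F: "space (F t) = space M"
  unfolding xi_filtration_def by (rule space_measure_of) (use xi_filtration_gen sets.space_closed in blast)

lemma sets_F: "sets (F t) = sigma_sets (space M)
  ({X u -` B \<inter> space M | u B. enat u \<le> t} \<union> {\<xi> u -` B \<inter> space M | u B. 1 \<le> u \<and> enat u \<le> t + 1})"
  unfolding xi_filtration_def by (rule sets_measure_of) (use xi_filtration_gen sets.space_closed in blast)

lemma sets_F_subset: "sets (F t) \<subseteq> events"
  unfolding sets_F by (rule sets.sigma_sets_subset[OF xi_filtration_gen])

lemma filtration_F: "filtration (space M) F"
proof
  show "space (F t) = space M" for t by (rule space_F)
  show "sets (F t) \<subseteq> sets (F t')" if "t \<le> t'" for t t'
  proof -
    have "t + 1 \<le> t' + 1" using that by (rule add_right_mono)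
    then show ?thesis
      unfolding sets_F using that by (intro sigma_sets_subseteq) (blast intro: order_trans)
  qed
qed

lemma measurable_X_F: "enat u \<le> t \<Longrightarrow> X u \<in> measurable (F t) (count_space UNIV)"
  by (auto simp: measurable_def space_F sets_F intro!: sigma_sets.Basic)

lemma known_F:
  assumes "B \<in> sets (F (enat t))"
  shows "known t (\<lambda>\<omega>. \<omega> \<in> B)"
  using assms unfolding sets_F
proof (induction rule: sigma_sets.induct)
  case (Basic B)
  then consider u C where "B = X u -` C \<inter> space M" "u \<le> t"
    | u C where "B = \<xi> u -` C \<inter> space M" "1 \<le> u" "u \<le> Suc t"
    by (auto simp: one_enat_def)
  then show ?case
  proof cases
    case 1
    show ?thesis using known_fun[OF known_X[OF 1(2)], of "\<lambda>x. x \<in> C"] unfolding known_def 1(1) by blast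
  next
    case 2
    show ?thesis using known_fun[OF known_xi[OF 2(2,3)], of "\<lambda>x. x \<in> C"] unfolding known_def 2(1) by blast
  qed
next
  case Empty
  then show ?case unfolding known_def by blast
next
  case (Compl B)
  show ?case using Compl.IH unfolding known_def by blast
next
  case (Union B)
  show ?case using Union.IH unfolding known_def UN_iff by blast
qed

lemma stopping_time_samp_time: "stopping_time F (samp_time X k)"
proof
  fix t
  show "Measurable.pred (F t) (\<lambda>\<omega>. samp_time X k \<omega> \<le> t)"
  proof (cases t)
    case (enat n)
    have "Measurable.pred (F t) (\<lambda>\<omega>. samp_time X k \<omega> \<le> enat m)" if "m \<le> n" for m
      using that
    proof (induction k arbitrary: m)
      case 0
      show ?case unfolding samp_time_0_le
        by (intro pred_intros_finite measurable_compose[OF measurable_X_F])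
          (use 0 in \<open>auto simp: enat\<close>)
    next
      case (Suc k)
      show ?case unfolding samp_time_Suc_le
        by (intro pred_intros_finite pred_intros_logic measurable_compose[OF measurable_X_F] Suc.IH)
          (use Suc.prems in \<open>auto simp: enat\<close>)
    qed
    then show ?thesis using enat by simp
  qed simp
qed

lemma measurable_samp_time: "samp_time X k \<in> measurable M borel"
  by (rule measurable_stopping_time[OF stopping_time_samp_time]) (auto simp: space_F dest: subsetD[OF sets_F_subset])

lemma measurable_\<tau> [measurable]: "(\<lambda>\<omega>. \<tau> k \<omega>) \<in> measurable M (count_space UNIV)"
  by (rule measurable_compose[OF measurable_samp_time the_enat_measurable])

lemma measurable_samp_chain [measurable]: "samp_chain X k \<in> measurable M (count_space UNIV)"
  unfolding samp_chain_def[abs_def] by (rule measurable_X_at[OF measurable_\<tau>])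

lemma sets_samp_sigma: "sets (samp_sigma M \<xi> X k) \<subseteq> events"
  and space_samp_sigma: "space (samp_sigma M \<xi> X k) = space M"
  and known_samp_sigma: "B \<in> sets (samp_sigma M \<xi> X k) \<Longrightarrow> known t (\<lambda>\<omega>. \<omega> \<in> B \<and> samp_time X k \<omega> \<le> enat t)"
proof -
  interpret filtration "space M" F by (rule filtration_F)
  note st = stopping_time_samp_time[of k]
  show "space (samp_sigma M \<xi> X k) = space M" unfolding samp_sigma_def by (rule space_pre_sigma)
  show "sets (samp_sigma M \<xi> X k) \<subseteq> events"
  proof
    fix B assume "B \<in> sets (samp_sigma M \<xi> X k)"
    then have "{\<omega> \<in> B. samp_time X k \<omega> \<le> \<infinity>} \<in> sets (F \<infinity>)"
      unfolding samp_sigma_def by (rule sets_pre_sigmaD[OF st])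
    then show "B \<in> events" using sets_F_subset by auto
  qed
  show "known t (\<lambda>\<omega>. \<omega> \<in> B \<and> samp_time X k \<omega> \<le> enat t)" if "B \<in> sets (samp_sigma M \<xi> X k)"
    using known_F[OF sets_pre_sigmaD[OF st that[unfolded samp_sigma_def], of "enat t"]] by simp
qed

text \<open>
  On \<open>\<tau>\<^sub>k = t\<close> all earlier sampling times are at most \<open>t\<close>, so the path up to \<open>t\<close> determines the
  sampled chain up to index \<open>k\<close> and hence whether it has entered \<open>A\<close>.
\<close>

lemma known_stopped:
  assumes B: "B \<in> sets (samp_sigma M \<xi> X k)"
  shows "known t (\<lambda>\<omega>. \<omega> \<in> {\<omega> \<in> B. X 0 \<omega> = \<alpha> \<and> samp_time X k \<omega> \<noteq> \<infinity> \<and> enat k < hit_time X A \<omega>} \<and> \<tau> k \<omega> = t)"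
  unfolding known_def
proof (intro ballI impI)
  have *: "(\<omega> \<in> {\<omega> \<in> B. X 0 \<omega> = \<alpha> \<and> samp_time X k \<omega> \<noteq> \<infinity> \<and> enat k < hit_time X A \<omega>} \<and> \<tau> k \<omega> = t)
      \<longrightarrow> (\<omega>' \<in> {\<omega> \<in> B. X 0 \<omega> = \<alpha> \<and> samp_time X k \<omega> \<noteq> \<infinity> \<and> enat k < hit_time X A \<omega>} \<and> \<tau> k \<omega>' = t)"
    if w: "\<omega> \<in> space M" "\<omega>' \<in> space M" "hist t \<omega> = hist t \<omega>'" for \<omega> \<omega>'
  proof
    assume a: "\<omega> \<in> {\<omega> \<in> B. X 0 \<omega> = \<alpha> \<and> samp_time X k \<omega> \<noteq> \<infinity> \<and> enat k < hit_time X A \<omega>} \<and> \<tau> k \<omega> = t"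
    then have st: "samp_time X k \<omega> = enat t" by auto
    have X: "X u \<omega> = X u \<omega>'" if "u \<le> t" for u
      by (rule knownD[OF known_X[OF that] w(3) w(1,2)])
    have le: "samp_time X i \<omega> \<le> enat t" if "i \<le> k" for i
      using samp_time_mono[OF that, of X \<omega>] st by simp
    have eq: "samp_time X i \<omega>' = samp_time X i \<omega>" if "i \<le> k" for i
      by (rule samp_time_cong[OF X le[OF that]])
    have chain: "samp_chain X i \<omega>' = samp_chain X i \<omega>" if "i \<le> k" for i
      using le[OF that] by (cases "samp_time X i \<omega>") (auto simp: samp_chain_def eq[OF that] X)
    have "\<omega>' \<in> B"
      using knownD[OF known_samp_sigma[OF B, of t] w(3) w(1,2)] a st by simp
    then show "\<omega>' \<in> {\<omega> \<in> B. X 0 \<omega> = \<alpha> \<and> samp_time X k \<omega> \<noteq> \<infinity> \<and> enat k < hit_time X A \<omega>} \<and> \<tau> k \<omega>' = t"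
      using a X[of 0] eq[of k] chain by (auto simp: less_hit_time_iff)
  qed
  fix \<omega> \<omega>' assume w: "\<omega> \<in> space M" "\<omega>' \<in> space M" "hist t \<omega> = hist t \<omega>'"
  show "(\<omega> \<in> {\<omega> \<in> B. X 0 \<omega> = \<alpha> \<and> samp_time X k \<omega> \<noteq> \<infinity> \<and> enat k < hit_time X A \<omega>} \<and> \<tau> k \<omega> = t)
      = (\<omega>' \<in> {\<omega> \<in> B. X 0 \<omega> = \<alpha> \<and> samp_time X k \<omega> \<noteq> \<infinity> \<and> enat k < hit_time X A \<omega>} \<and> \<tau> k \<omega>' = t)"
    using *[OF w] *[OF w(2,1) w(3)[symmetric]] by blast
qed

text \<open>
  Induction on \<open>k\<close>.  The start is an excursion as well, since \<open>\<alpha>\<close> has an idle server other than the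
  Last-Idle one; so the first sampling time ends an excursion that begins at time 0.
\<close>

lemma integrable_energy_samp_chain:
  assumes \<alpha>: "nonLI_idle \<alpha>"
  shows "integrable M (\<lambda>\<omega>. indicator {\<omega> \<in> space M. X 0 \<omega> = \<alpha>} \<omega> * energy (samp_chain X k \<omega>))"
proof -
  define S where "S = {\<omega> \<in> space M. X 0 \<omega> = \<alpha>}"
  have S[measurable]: "S \<in> events" unfolding S_def by measurable
  have energy[measurable]: "energy \<in> borel_measurable (count_space UNIV)" by simp
  have AE_S: "AE \<omega> in M. \<omega> \<in> S \<longrightarrow> samp_time X 0 \<omega> = enat (next_samp (\<lambda>t. X t \<omega>) 0) \<and>
     (\<forall>k. \<exists>t. samp_time X k \<omega> = enat t \<and> nonLI_idle (X t \<omega>) \<and>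
        samp_time X (Suc k) \<omega> = enat (next_samp (\<lambda>t. X t \<omega>) t))"
    using AE_samp_time by eventually_elim (use \<alpha> in \<open>auto simp: S_def\<close>)
  have K: "ennreal (1 + A2) * x < \<infinity>" if "x < \<infinity>" for x
    using that by (simp add: ennreal_mult_less_top)
  have "(\<integral>\<^sup>+\<omega>. ennreal (energy (samp_chain X k \<omega>)) * indicator S \<omega> \<partial>M) < \<infinity>"
  proof (induction k)
    case 0
    have k0: "known t (\<lambda>\<omega>. \<omega> \<in> S \<and> (0 :: nat) = t)" for t
      using known_fun[OF known_X[of 0 t], of "\<lambda>x. x = \<alpha> \<and> 0 = t"] unfolding known_def S_def by blast
    have "(\<integral>\<^sup>+\<omega>. ennreal (energy (samp_chain X 0 \<omega>)) * indicator S \<omega> \<partial>M)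
        = (\<integral>\<^sup>+\<omega>. ennreal (energy (X (next_samp (\<lambda>t. X t \<omega>) 0) \<omega>)) * indicator S \<omega> \<partial>M)"
      by (rule nn_integral_cong_AE) (use AE_S in eventually_elim, auto simp: samp_chain_def indicator_def simp del: samp_time.simps)
    also have "\<dots> \<le> ennreal (1 + A2) * (\<integral>\<^sup>+\<omega>. ennreal (energy (X 0 \<omega>)) * indicator S \<omega> \<partial>M)"
      by (rule energy_growth_random_time[where \<theta>="\<lambda>_. 0", OF S k0]) (use \<alpha> in \<open>auto simp: S_def\<close>)
    also have "(\<integral>\<^sup>+\<omega>. ennreal (energy (X 0 \<omega>)) * indicator S \<omega> \<partial>M) = (\<integral>\<^sup>+\<omega>. ennreal (energy \<alpha>) * indicator S \<omega> \<partial>M)"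
      by (rule nn_integral_cong) (auto simp: S_def indicator_def)
    also have "\<dots> = ennreal (energy \<alpha>) * emeasure M S" by (rule nn_integral_cmult_indicator[OF S])
    also have "ennreal (1 + A2) * \<dots> < \<infinity>"
      by (rule K) (simp add: emeasure_eq_measure ennreal_mult_less_top)
    finally show ?case .
  next
    case (Suc k)
    \<comment> \<open>the empty target is never hit, so this is the event \<open>X(0) = \<alpha>\<close> with \<open>\<tau>\<^sub>k\<close> finite\<close>
    define E where "E = {\<omega> \<in> space M. X 0 \<omega> = \<alpha> \<and> samp_time X k \<omega> \<noteq> \<infinity> \<and> enat k < hit_time X {} \<omega>}"
    have sp: "space M \<in> sets (samp_sigma M \<xi> X k)"
      using sets.top[of "samp_sigma M \<xi> X k"] by (simp add: space_samp_sigma)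
    have hit: "enat k < hit_time X {} \<omega>" for \<omega> by (simp add: less_hit_time_iff)
    have fin: "{\<omega> \<in> space M. samp_time X k \<omega> \<noteq> \<infinity>} \<in> events"
    proof -
      have "samp_time X k -` (- {\<infinity>}) \<inter> space M \<in> events"
        by (rule measurable_sets[OF measurable_samp_time]) auto
      then show ?thesis by (rule back_subst[where P="\<lambda>x. x \<in> events"]) auto
    qed
    have E: "E \<in> events"
    proof -
      have "E = S \<inter> {\<omega> \<in> space M. samp_time X k \<omega> \<noteq> \<infinity>}" by (auto simp: E_def S_def hit)
      then show ?thesis using S fin by simp
    qed
    have kn: "known t (\<lambda>\<omega>. \<omega> \<in> E \<and> \<tau> k \<omega> = t)" for t
      unfolding E_def by (rule known_stopped[OF sp])
    have "(\<integral>\<^sup>+\<omega>. ennreal (energy (samp_chain X (Suc k) \<omega>)) * indicator S \<omega> \<partial>M)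
        = (\<integral>\<^sup>+\<omega>. ennreal (energy (X (next_samp (\<lambda>t. X t \<omega>) (\<tau> k \<omega>)) \<omega>)) * indicator E \<omega> \<partial>M)"
    proof (rule nn_integral_cong_AE, use AE_S in eventually_elim)
      fix \<omega> assume *: "\<omega> \<in> S \<longrightarrow> samp_time X 0 \<omega> = enat (next_samp (\<lambda>t. X t \<omega>) 0) \<and>
        (\<forall>k. \<exists>t. samp_time X k \<omega> = enat t \<and> nonLI_idle (X t \<omega>) \<and>
          samp_time X (Suc k) \<omega> = enat (next_samp (\<lambda>t. X t \<omega>) t))"
      show "ennreal (energy (samp_chain X (Suc k) \<omega>)) * indicator S \<omega>
        = ennreal (energy (X (next_samp (\<lambda>t. X t \<omega>) (\<tau> k \<omega>)) \<omega>)) * indicator E \<omega>"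
      proof (cases "\<omega> \<in> S")
        case True
        then obtain t where t: "samp_time X k \<omega> = enat t" "samp_time X (Suc k) \<omega> = enat (next_samp (\<lambda>t. X t \<omega>) t)"
          using * by blast
        have "\<omega> \<in> E" using True t by (simp add: E_def S_def hit)
        then show ?thesis using True t by (simp add: samp_chain_def del: samp_time.simps)
      next
        case False
        then have "\<omega> \<notin> E" by (auto simp: E_def S_def)
        then show ?thesis using False by simp
      qed
    qed
    also have "\<dots> \<le> ennreal (1 + A2) * (\<integral>\<^sup>+\<omega>. ennreal (energy (X (\<tau> k \<omega>) \<omega>)) * indicator E \<omega> \<partial>M)"
    proof (rule energy_growth_random_time[OF E kn measurable_\<tau>])
      show "AE \<omega> in M. \<omega> \<in> E \<longrightarrow> nonLI_idle (X (\<tau> k \<omega>) \<omega>)"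
        using AE_S
      proof eventually_elim
        case (elim \<omega>)
        show ?case
        proof
          assume "\<omega> \<in> E"
          then have "\<omega> \<in> S" by (auto simp: E_def S_def)
          then obtain t where "samp_time X k \<omega> = enat t" "nonLI_idle (X t \<omega>)" using elim by blast
          then show "nonLI_idle (X (\<tau> k \<omega>) \<omega>)" by simp
        qed
      qed
    qed
    also have "\<dots> \<le> ennreal (1 + A2) * (\<integral>\<^sup>+\<omega>. ennreal (energy (samp_chain X k \<omega>)) * indicator S \<omega> \<partial>M)"
      by (intro mult_left_mono nn_integral_mono) (auto simp: samp_chain_def E_def S_def indicator_def)
    also have "\<dots> < \<infinity>" by (rule K[OF Suc.IH])
    finally show ?case .
  qed
  moreover have "(\<integral>\<^sup>+\<omega>. ennreal (energy (samp_chain X k \<omega>)) * indicator S \<omega> \<partial>M)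
      = (\<integral>\<^sup>+\<omega>. ennreal (norm (indicator S \<omega> * energy (samp_chain X k \<omega>))) \<partial>M)"
    by (intro nn_integral_cong) (auto simp: indicator_def energy_nonneg)
  ultimately show ?thesis
    unfolding S_def[symmetric] by (intro integrableI_bounded) auto
qed

end

section \<open>Conditional drift of the sampled chain\<close>

context bounded_persistent_idle
begin

text \<open>
  It suffices that \<open>drift + \<epsilon> gap\<close> has nonpositive integral over every set of the stopped \<open>\<sigma>\<close>-algebra.
  Intersected with \<open>X(0) = \<alpha>\<close> and \<open>k < \<sigma>\<close>, such a set is an event on which \<open>Y\<^sub>k\<close> lies outside \<open>A\<close>
  and the drift over the excursion from \<open>\<tau>\<^sub>k\<close> to \<open>\<tau>\<^sub>k\<^sub>+\<^sub>1\<close> is negative.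
\<close>

lemma conditional_drift:
  fixes k :: nat
  assumes \<alpha>: "nonLI_idle \<alpha>" and pos: "0 < prob {\<omega> \<in> space M. X 0 \<omega> = \<alpha>}"
    and par: "drift_parameters pa ps smax \<gamma> \<epsilon> R"
    and A: "\<And>\<beta>. \<beta> \<in> state_space i1 pa ps \<Longrightarrow> \<beta> \<notin> A \<Longrightarrow> \<exists>k. R \<le> fst \<beta> k"
  defines "P \<equiv> started_at M X \<alpha>"
    and "G \<equiv> samp_sigma M \<xi> X k"
    and "alive \<equiv> \<lambda>\<omega>. of_bool (enat k < hit_time X A \<omega>)"
  defines "drift \<equiv> \<lambda>\<omega>. (lyapunov \<gamma> (samp_chain X (Suc k) \<omega>) - lyapunov \<gamma> (samp_chain X k \<omega>)) * alive \<omega>"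
    and "gap \<equiv> \<lambda>\<omega>. samp_gap X k \<omega> * alive \<omega>"
  shows "integrable P drift" "integrable P gap"
    "AE \<omega> in P. real_cond_exp P G drift \<omega> \<le> - \<epsilon> * real_cond_exp P G gap \<omega>"
proof -
  have \<gamma>: "0 < \<gamma>" "\<gamma> \<le> 1" using par by (auto simp: drift_parameters_def)
  define S where "S = {\<omega> \<in> space M. X 0 \<omega> = \<alpha>}"
  have S[measurable]: "S \<in> events" unfolding S_def by measurable
  have S0: "0 < prob S" using pos by (simp add: S_def)
  have P: "P = uniform_measure M S" by (simp add: P_def started_at_def S_def)
  have [measurable]: "energy \<in> borel_measurable (count_space UNIV)" "lyapunov \<gamma> \<in> borel_measurable (count_space UNIV)"
    by simp_all
  have alive_pred[measurable]: "Measurable.pred M (\<lambda>\<omega>. enat k < hit_time X A \<omega>)"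
    unfolding less_hit_time_iff by measurable
  have alive[measurable]: "alive \<in> borel_measurable M"
    unfolding alive_def by measurable
  have drift[measurable]: "drift \<in> borel_measurable M" unfolding drift_def by measurable
  have gap[measurable]: "gap \<in> borel_measurable M"
    unfolding gap_def samp_gap_def by measurable
  have a01: "alive \<omega> = 0 \<or> alive \<omega> = 1" for \<omega> by (simp add: alive_def)

  have AE_S: "AE \<omega> in M. \<omega> \<in> S \<longrightarrow> (\<exists>t. samp_time X k \<omega> = enat t \<and> nonLI_idle (X t \<omega>) \<and>
        samp_time X (Suc k) \<omega> = enat (next_samp (\<lambda>t. X t \<omega>) t) \<and>
        t < next_samp (\<lambda>t. X t \<omega>) t \<and> real (next_samp (\<lambda>t. X t \<omega>) t) - real t \<le> energy (X t \<omega>))"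
    using AE_samp_time AE_next_samp
  proof eventually_elim
    case (elim \<omega>)
    show ?case
    proof
      assume "\<omega> \<in> S"
      then have "nonLI_idle (X 0 \<omega>)" using \<alpha> by (simp add: S_def)
      then obtain t where "samp_time X k \<omega> = enat t" "nonLI_idle (X t \<omega>)"
          "samp_time X (Suc k) \<omega> = enat (next_samp (\<lambda>t. X t \<omega>) t)" using elim(1) by blast
      then show "\<exists>t. samp_time X k \<omega> = enat t \<and> nonLI_idle (X t \<omega>) \<and>
        samp_time X (Suc k) \<omega> = enat (next_samp (\<lambda>t. X t \<omega>) t) \<and>
        t < next_samp (\<lambda>t. X t \<omega>) t \<and> real (next_samp (\<lambda>t. X t \<omega>) t) - real t \<le> energy (X t \<omega>)"
        using elim(2) by (intro exI[of _ t]) blast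
    qed
  qed

  note en = integrable_energy_samp_chain[OF \<alpha>, folded S_def]
  have int_drift: "integrable M (\<lambda>\<omega>. indicator S \<omega> * drift \<omega>)"
  proof (rule Bochner_Integration.integrable_bound)
    show "integrable M (\<lambda>\<omega>. indicator S \<omega> * energy (samp_chain X (Suc k) \<omega>) + indicator S \<omega> * energy (samp_chain X k \<omega>))"
      using en by simp
    show "AE \<omega> in M. norm (indicator S \<omega> * drift \<omega>)
        \<le> norm (indicator S \<omega> * energy (samp_chain X (Suc k) \<omega>) + indicator S \<omega> * energy (samp_chain X k \<omega>))"
    proof (rule AE_I2)
      fix \<omega>
      show "norm (indicator S \<omega> * drift \<omega>)
        \<le> norm (indicator S \<omega> * energy (samp_chain X (Suc k) \<omega>) + indicator S \<omega> * energy (samp_chain X k \<omega>))"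
        using lyapunov_nonneg[of \<gamma> "samp_chain X (Suc k) \<omega>"] lyapunov_nonneg[of \<gamma> "samp_chain X k \<omega>"]
          lyapunov_le_energy[OF \<gamma>, of "samp_chain X (Suc k) \<omega>"] lyapunov_le_energy[OF \<gamma>, of "samp_chain X k \<omega>"]
          a01[of \<omega>]
        by (auto simp: indicator_def drift_def)
    qed
  qed measurable
  have int_gap: "integrable M (\<lambda>\<omega>. indicator S \<omega> * gap \<omega>)"
  proof (rule Bochner_Integration.integrable_bound[OF en[of k]])
    show "AE \<omega> in M. norm (indicator S \<omega> * gap \<omega>) \<le> norm (indicator S \<omega> * energy (samp_chain X k \<omega>))"
      using AE_S
    proof eventually_elim
      case (elim \<omega>)
      show ?case
      proof (cases "\<omega> \<in> S")
        case True
        then obtain t where "samp_time X k \<omega> = enat t"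
          "samp_time X (Suc k) \<omega> = enat (next_samp (\<lambda>t. X t \<omega>) t)"
          "t < next_samp (\<lambda>t. X t \<omega>) t" "real (next_samp (\<lambda>t. X t \<omega>) t) - real t \<le> energy (X t \<omega>)"
          using elim by blast
        then show ?thesis
          using True a01[of \<omega>] energy_nonneg[of "X t \<omega>"]
          by (auto simp: gap_def samp_gap_def samp_chain_def simp del: samp_time.simps)
      qed simp
    qed
  qed measurable

  show ipd: "integrable P drift" and ipg: "integrable P gap"
    unfolding P by (simp_all add: integrable_uniform_measure_iff[OF S S0] int_drift int_gap)

  have emS: "emeasure M S \<noteq> 0" "emeasure M S \<noteq> \<infinity>" using S0 by (simp_all add: emeasure_eq_measure)
  have "prob_space P" unfolding P by (rule prob_space_uniform_measure[OF emS])
  then interpret P: prob_space P .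
  interpret finite_measure_subalgebra P G
    by unfold_locales
      (use sets_samp_sigma[of k] in \<open>auto simp: subalgebra_def P G_def space_samp_sigma\<close>)

  have nonpos: "(\<integral>\<omega>\<in>B. drift \<omega> + \<epsilon> * gap \<omega> \<partial>P) \<le> 0" if B: "B \<in> sets G" for B
  proof -
    have B': "B \<in> sets (samp_sigma M \<xi> X k)" using B by (simp add: G_def)
    have BM[measurable]: "B \<in> events" using B' sets_samp_sigma by blast
    define E where "E = {\<omega> \<in> B. X 0 \<omega> = \<alpha> \<and> samp_time X k \<omega> \<noteq> \<infinity> \<and> enat k < hit_time X A \<omega>}"
    have kn: "known t (\<lambda>\<omega>. \<omega> \<in> E \<and> \<tau> k \<omega> = t)" for t
      unfolding E_def by (rule known_stopped[OF B'])
    \<comment> \<open>countable union of the events on which \<open>\<tau>\<^sub>k\<close> has a given value\<close>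
    have E: "E \<in> events"
    proof -
      have sub: "E \<subseteq> space M" using sets.sets_into_space[OF BM] by (auto simp: E_def)
      have "{\<omega> \<in> E. \<tau> k \<omega> = t} \<in> events" for t
        by (rule known_event[of t]) (use kn[of t] sub in auto)
      then have "(\<Union>t. {\<omega> \<in> E. \<tau> k \<omega> = t}) \<in> events" by blast
      then show ?thesis by (rule back_subst[where P="\<lambda>x. x \<in> events"]) auto
    qed
    let ?D = "\<lambda>\<omega>. lyapunov \<gamma> (X (next_samp (\<lambda>t. X t \<omega>) (\<tau> k \<omega>)) \<omega>) - lyapunov \<gamma> (X (\<tau> k \<omega>) \<omega>)
      + \<epsilon> * (real (next_samp (\<lambda>t. X t \<omega>) (\<tau> k \<omega>)) - real (\<tau> k \<omega>))"
    have [measurable]: "(\<lambda>\<omega>. X (\<tau> k \<omega>) \<omega>) \<in> measurable M (count_space UNIV)"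
      "(\<lambda>\<omega>. next_samp (\<lambda>t. X t \<omega>) (\<tau> k \<omega>)) \<in> measurable M (count_space UNIV)"
      "(\<lambda>\<omega>. X (next_samp (\<lambda>t. X t \<omega>) (\<tau> k \<omega>)) \<omega>) \<in> measurable M (count_space UNIV)"
      by (intro measurable_X_at measurable_next_samp_at measurable_\<tau>)+
    have ae: "AE \<omega> in M. indicator S \<omega> * (indicator B \<omega> * (drift \<omega> + \<epsilon> * gap \<omega>)) = indicator E \<omega> * ?D \<omega>"
      using AE_S
    proof eventually_elim
      case (elim \<omega>)
      show ?case
      proof (cases "\<omega> \<in> S \<and> \<omega> \<in> B")
        case True
        then obtain t where t: "samp_time X k \<omega> = enat t"
          "samp_time X (Suc k) \<omega> = enat (next_samp (\<lambda>t. X t \<omega>) t)" using elim by blast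
        have "\<omega> \<in> E \<longleftrightarrow> enat k < hit_time X A \<omega>" using True t by (simp add: E_def S_def)
        then show ?thesis using True t
          by (auto simp: drift_def gap_def alive_def samp_gap_def samp_chain_def simp del: samp_time.simps)
      next
        case False
        then have "\<omega> \<notin> E" using sets.sets_into_space[OF BM] by (auto simp: E_def S_def)
        then show ?thesis using False by auto
      qed
    qed
    have int0: "integrable M (\<lambda>\<omega>. indicator S \<omega> * (drift \<omega> + \<epsilon> * gap \<omega>))"
      using int_drift int_gap by (simp add: distrib_left mult.left_commute[of _ \<epsilon>])
    have int1: "integrable M (\<lambda>\<omega>. indicator S \<omega> * (indicator B \<omega> * (drift \<omega> + \<epsilon> * gap \<omega>)))"
      by (rule Bochner_Integration.integrable_bound[OF int0]) (auto simp: indicator_def)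
    have m: "(\<lambda>\<omega>. indicator E \<omega> * ?D \<omega>) \<in> borel_measurable M" using E by measurable
    have int: "integrable M (\<lambda>\<omega>. indicator E \<omega> * ?D \<omega>)"
      using integrable_cong_AE[OF _ m ae] int1 by simp
    have "(\<integral>\<omega>\<in>B. drift \<omega> + \<epsilon> * gap \<omega> \<partial>P)
        = (\<integral>\<omega>. indicator S \<omega> * (indicator B \<omega> * (drift \<omega> + \<epsilon> * gap \<omega>)) \<partial>M) / prob S"
      unfolding P set_lebesgue_integral_def real_scaleR_def by (rule integral_uniform_measure[OF S S0]) measurable
    also have "(\<integral>\<omega>. indicator S \<omega> * (indicator B \<omega> * (drift \<omega> + \<epsilon> * gap \<omega>)) \<partial>M)
        = expectation (\<lambda>\<omega>. indicator E \<omega> * ?D \<omega>)"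
      by (rule integral_cong_AE[OF _ m ae]) measurable
    also have "\<dots> / prob S \<le> 0"
    proof -
      have "AE \<omega> in M. \<omega> \<in> E \<longrightarrow> nonLI_idle (X (\<tau> k \<omega>) \<omega>) \<and> (\<exists>i. R \<le> fst (X (\<tau> k \<omega>) \<omega>) i)"
        using AE_S AE_state_space
      proof eventually_elim
        case (elim \<omega>)
        show ?case
        proof
          assume w: "\<omega> \<in> E"
          then have "\<omega> \<in> S" using sets.sets_into_space[OF BM] by (auto simp: E_def S_def)
          then obtain t where t: "samp_time X k \<omega> = enat t" "nonLI_idle (X t \<omega>)" using elim by blast
          have "samp_chain X k \<omega> \<notin> A" using w by (auto simp: E_def less_hit_time_iff)
          then show "nonLI_idle (X (\<tau> k \<omega>) \<omega>) \<and> (\<exists>i. R \<le> fst (X (\<tau> k \<omega>) \<omega>) i)"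
            using t A elim(2) by (simp add: samp_chain_def)
        qed
      qed
      from negative_drift_random_time[OF E kn measurable_\<tau> this par int]
      show ?thesis using S0 by (simp add: divide_nonpos_pos)
    qed
    finally show ?thesis .
  qed
  have "AE \<omega> in P. real_cond_exp P G (\<lambda>\<omega>. drift \<omega> + \<epsilon> * gap \<omega>) \<omega> \<le> 0"
    by (rule real_cond_exp_nonposI[OF _ nonpos]) (use ipd ipg in simp_all)
  moreover have "AE \<omega> in P. real_cond_exp P G (\<lambda>\<omega>. drift \<omega> + \<epsilon> * gap \<omega>) \<omega>
      = real_cond_exp P G drift \<omega> + real_cond_exp P G (\<lambda>\<omega>. \<epsilon> * gap \<omega>) \<omega>"
    by (rule real_cond_exp_add) (use ipd ipg in simp_all)
  moreover have "AE \<omega> in P. real_cond_exp P G (\<lambda>\<omega>. \<epsilon> * gap \<omega>) \<omega> = \<epsilon> * real_cond_exp P G gap \<omega>"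
    by (rule real_cond_exp_cmult[OF ipg])
  ultimately show "AE \<omega> in P. real_cond_exp P G drift \<omega> \<le> - \<epsilon> * real_cond_exp P G gap \<omega>"
    by eventually_elim simp
qed

end

theorem lemma3p3:
  fixes i1 :: "'n::finite"
    and pa :: "nat pmf"
    and ps :: "'n \<Rightarrow> nat pmf"
    and smax :: nat
  assumes "pmf pa 0 > 0"
    and "integrable (measure_pmf pa) real"
    and "integrable (measure_pmf pa) (\<lambda>x. (real x)\<^sup>2)"
    and "\<And>i. set_pmf (ps i) \<subseteq> {1..smax}"
    and "measure_pmf.expectation pa real < (\<Sum>i\<in>UNIV. measure_pmf.expectation (ps i) real)"
  shows "\<exists>\<gamma> \<epsilon> (A :: 'n state set).
      0 < \<gamma> \<and> \<gamma> \<le> 1 \<and> 0 < \<epsilon> \<and>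
      finite A \<and> A \<noteq> {} \<and> A \<subseteq> state_space i1 pa ps \<and>
      (\<forall>(M :: 'w measure) a s \<xi> X. persistent_idle M i1 pa ps a s \<xi> X \<longrightarrow>
        (\<forall>k. \<forall>\<alpha> \<in> state_space_star i1 pa ps - A.
          \<P>(\<omega> in M. X 0 \<omega> = \<alpha>) > 0 \<longrightarrow>
          (let P = started_at M X \<alpha>;
               F = samp_sigma M \<xi> X k;
               alive = (\<lambda>\<omega>. of_bool (enat k < hit_time X A \<omega>));
               drift = (\<lambda>\<omega>. (lyapunov \<gamma> (samp_chain X (Suc k) \<omega>)
                              - lyapunov \<gamma> (samp_chain X k \<omega>)) * alive \<omega>);
               gap = (\<lambda>\<omega>. samp_gap X k \<omega> * alive \<omega>)
           in integrable P drift \<and> integrable P gap \<and>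
              (AE \<omega> in P. real_cond_exp P F drift \<omega> \<le> - \<epsilon> * real_cond_exp P F gap \<omega>))))"
proof -
  obtain \<gamma> \<epsilon> R where par: "drift_parameters pa ps smax \<gamma> \<epsilon> R"
    using drift_parameters_exist[OF assms(5)] by blast
  define A where "A = {\<beta> \<in> state_space i1 pa ps. \<forall>k. fst \<beta> k < R}"
  have "A \<subseteq> PiE UNIV (\<lambda>_. {..<R}) \<times> UNIV" by (auto simp: A_def)
  then have fin: "finite A" by (rule finite_subset) (intro finite_cartesian_product finite_PiE, auto)
  have "pmf (kernel_pow i1 pa ps 0 (\<lambda>_. 0, i1)) (\<lambda>_. 0, i1) > 0" by simp
  then have "(\<lambda>_. 0, i1) \<in> state_space i1 pa ps" unfolding state_space_def by blast
  then have "(\<lambda>_. 0, i1) \<in> A" using par by (simp add: A_def drift_parameters_def)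
  then have ne: "A \<noteq> {}" by blast
  show ?thesis
  proof (rule exI[of _ \<gamma>], rule exI[of _ \<epsilon>], rule exI[of _ A], intro conjI allI impI ballI)
    show "0 < \<gamma>" "\<gamma> \<le> 1" "0 < \<epsilon>" using par by (auto simp: drift_parameters_def)
    show "finite A" "A \<noteq> {}" "A \<subseteq> state_space i1 pa ps" using fin ne by (auto simp: A_def)
    fix M :: "'w measure" and a s \<xi> X k \<alpha>
    assume pi: "persistent_idle M i1 pa ps a s \<xi> X" and \<alpha>: "\<alpha> \<in> state_space_star i1 pa ps - A"
      and pos: "\<P>(\<omega> in M. X 0 \<omega> = \<alpha>) > 0"
    interpret bounded_persistent_idle M i1 pa ps a s \<xi> X smax
      using pi assms by (simp add: bounded_persistent_idle_def bounded_persistent_idle_axioms_def)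
    have "nonLI_idle \<alpha>" using \<alpha> by (simp add: state_space_star_def)
    moreover have "\<exists>k. R \<le> fst \<beta> k" if "\<beta> \<in> state_space i1 pa ps" "\<beta> \<notin> A" for \<beta>
      using that by (auto simp: A_def not_less)
    ultimately show "let P = started_at M X \<alpha>;
               F = samp_sigma M \<xi> X k;
               alive = (\<lambda>\<omega>. of_bool (enat k < hit_time X A \<omega>));
               drift = (\<lambda>\<omega>. (lyapunov \<gamma> (samp_chain X (Suc k) \<omega>)
                              - lyapunov \<gamma> (samp_chain X k \<omega>)) * alive \<omega>);
               gap = (\<lambda>\<omega>. samp_gap X k \<omega> * alive \<omega>)
           in integrable P drift \<and> integrable P gap \<and>
              (AE \<omega> in P. real_cond_exp P F drift \<omega> \<le> - \<epsilon> * real_cond_exp P F gap \<omega>)"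
      unfolding Let_def using conditional_drift[OF _ pos par, of A k] by blast
  qed
qed

end
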